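(* Consider the drone-to-detector optical link described in the context. The drone's position $\mathbf r=(\mu_x+\epsilon_x,\mu_y+\epsilon_y,\mu_z+\epsilon_z)$ and beam orientation $\boldsymbol\omega=(\theta,\phi)=(\mu_\theta+\epsilon_\theta,\mu_\phi+\epsilon_\phi)$ have independent Gaussian fluctuations $\epsilon_s\sim\mathcal N(0,\sigma_s^2)$, $s\in\{x,y,z,\theta,\phi\}$. Tracking is perfect, i.e. the mean beam is directed from the mean position to the center of the detector. Assume $\sigma_s\to0$ for all $s\in\{x,y,z,\theta,\phi\}$. In this regime the distance $u$ between the center of the beam footprint and the center of the detector follows the Hoyt (Nakagami-$q$) distribution $\mathcal H(q,\Omega)$ with $$q=\sqrt{\frac{\min\{\lambda_1,\lambda_2\}}{\max\{\lambda_1,\lambda_2\}}},\qquad \Omega=\lambda_1+\lambda_2,$$ where $\lambda_1,\lambda_2$ are the eigenvalues of the matrix $\boldsymbol\Sigma$ given in the context. Based on this distribution of $u$, and with $A_0$ and $k_{\mathrm{mean}}$ taken as constants evaluated at the mean position and mean orientation, the approximate geometric loss $$\tilde h_g=A_0\exp\left(-\frac{2u^2}{k_{\mathrm{mean}}w^2(L)}\right)$$ has probability density function $$f_{\tilde h_g}(x)=\frac{\varpi}{A_0}\left(\frac{x}{A_0}\right)^{\frac{(1+q^2)\varpi}{2q}-1}I_0\left(-\frac{(1-q^2)\varpi}{2q}\ln\left(\frac{x}{A_0}\right)\right),\qquad 0\le x\le A_0,$$ where $\varpi=\frac{(1+q^2)k_{\mathrm{mean}}w^2(L)}{4q\Omega}$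 is a constant and $I_0$ is the zero-order modified Bessel function of the first kind.
   Context: Geometry: a circular photo-detector of radius $a>0$ lies in the plane $x=0$, centered at the origin. A laser source (the drone) is at $\mathbf r=(r_x,r_y,r_z)$ and emits a Gaussian beam along the direction $(\sin\phi\cos\theta,\sin\phi\sin\theta,\cos\phi)$. The beam line meets the plane $x=0$ at the footprint center $(0,f_y,f_z)$ with $f_y=r_y-r_x\tan\theta$ and $f_z=r_z-r_x\frac{\cot\phi}{\cos\theta}$, and $u=\sqrt{f_y^2+f_z^2}$. The assumption $\sigma_s\to0$ means that $f_y,f_z$ are given by their first-order expansions in the $\epsilon_s$, with terms of order higher than one dropped. Then $(f_y,f_z)$ is bivariate Gaussian with mean zero and covariance $\boldsymbol\Sigma$. Perfect tracking: $\mu_\theta=\pi+\tan^{-1}(\mu_y/\mu_x)$ if $\mu_x>0$ and $\mu_\theta=\tan^{-1}(\mu_y/\mu_x)$ otherwise, and $\mu_\phi=\pi-\cos^{-1}\big(\mu_z/\sqrt{\mu_x^2+\mu_y^2+\mu_z^2}\big)$. Matrix: $$\boldsymbol\Sigma=\begin{bmatrix}\sigma_y^2+c_1^2\sigma_x^2+c_2^2\sigma_\theta^2 & c_1c_5\sigma_x^2+c_2c_4\sigma_\theta^2\\ c_1c_5\sigma_x^2+c_2c_4\sigma_\theta^2 & \sigma_z^2+c_3^2\sigma_\phi^2+c_4^2\sigma_\theta^2+c_5^2\sigma_x^2\end{bmatrix},$$ with $c_1=-\tan\mu_\theta$, $c_2=-\frac{\mu_x}{\cos^2\mu_\theta}$,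 $c_3=\frac{\mu_x}{\sin^2\mu_\phi\cos\mu_\theta}$, $c_4=-\frac{\mu_x\cot\mu_\phi\tan\mu_\theta}{\cos\mu_\theta}$, $c_5=-\frac{\cot\mu_\phi}{\cos\mu_\theta}$. Hoyt distribution: if $g_1,g_2$ are independent zero-mean Gaussian variables with variances $\lambda_1,\lambda_2$, then $\sqrt{g_1^2+g_2^2}\sim\mathcal H(q,\Omega)$ with $q,\Omega$ as in the claim. Its density on $[0,\infty)$ is $\frac{(1+q^2)t}{q\Omega}\exp\big(-\frac{(1+q^2)^2t^2}{4q^2\Omega}\big)I_0\big(\frac{(1-q^4)t^2}{4q^2\Omega}\big)$. Beam width: $w(L)=w_0\sqrt{1+\big(1+\frac{2w_0^2}{\rho^2(L)}\big)\big(\frac{\lambda L}{\pi w_0^2}\big)^2}$. Here $L$ is the drone-detector distance $\Vert\mathbf r\Vert$, taken at the mean position. Moreover, $w_0$ is the beam waist radius, $\lambda$ the optical wavelength, $\rho(L)=(0.55\,C_n^2k^2L)^{-3/5}$ the coherence length, $k=2\pi/\lambda$, and $C_n^2$ the (constant) index of refraction structure parameter. Constants $A_0,k_{\mathrm{mean}}$: with $(\theta,\phi)=(\mu_\theta,\mu_\phi)$ put $\rho_y=\cos^2\phi+\sin^2\phi\cos^2\theta$, $\rho_z=\sin^2\phi$, $\rho_{yz}=-\cos\phi\sin\phi\sin\theta$, $\rho_{\min}=\frac{2}{\rho_y+\rho_z+\sqrt{(\rho_y-\rho_z)^2+4\rho_{yz}^2}}$, $\rho_{\max}=\frac{2}{\rho_y+\rho_z-\sqrt{(\rho_y-\rho_z)^2+4\rho_{yz}^2}}$.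 For $i\in\{\min,\max\}$ let $\nu_i=\frac{a}{w(L)}\sqrt{\frac{\pi}{2\rho_i}}$ and $k_i=\frac{\sqrt\pi\,\rho_i\,\mathrm{erf}(\nu_i)}{2\nu_i\exp(-\nu_i^2)}$, where $\mathrm{erf}(x)=\frac1{\sqrt\pi}\int_{-x}^{x}e^{-t^2}\,\mathrm dt$. Then $A_0=\mathrm{erf}(\nu_{\min})\,\mathrm{erf}(\nu_{\max})$ and $k_{\mathrm{mean}}=\frac{k_{\min}+k_{\max}}2$. In reality $A_0$ and $k_{\mathrm{mean}}$ depend on the random $\boldsymbol\omega$, but they are assumed approximately constant. *)

theory Defs
  imports "HOL-Probability.Probability" "Jordan_Normal_Form.Char_Poly"
begin

section \<open>Special functions\<close>

definition erf :: "real \<Rightarrow> real" where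
  "erf x = 1 / sqrt pi * (LBINT t=-x..x. exp (- t\<^sup>2))"

text \<open>Modified Bessel function of the first kind, of integer order \<open>n\<close>, by its power series.\<close>

definition bessel_I :: "nat \<Rightarrow> real \<Rightarrow> real" where
  "bessel_I n x = (\<Sum>m. (x / 2) ^ (2 * m + n) / (fact m * fact (m + n)))"

text \<open>
  Density of the Hoyt (Nakagami-q) distribution, to be read with respect to Lebesgue measure.
\<close>

definition hoyt_density :: "real \<Rightarrow> real \<Rightarrow> real \<Rightarrow> real" where
  "hoyt_density q \<Omega> t =
     (if 0 \<le> t
      then (1 + q\<^sup>2) * t / (q * \<Omega>) * exp (- ((1 + q\<^sup>2)\<^sup>2 * t\<^sup>2 / (4 * q\<^sup>2 * \<Omega>)))
           * bessel_I 0 ((1 - q ^ 4) * t\<^sup>2 / (4 * q\<^sup>2 * \<Omega>))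
      else 0)"


section \<open>Beam footprint\<close>

text \<open>A state is a pair of a position \<open>(r\<^sub>x, r\<^sub>y, r\<^sub>z)\<close> and an orientation \<open>(\<theta>, \<phi>)\<close>.\<close>

type_synonym state = "(real \<times> real \<times> real) \<times> (real \<times> real)"

definition footprint_y :: "state \<Rightarrow> real" where
  "footprint_y = (\<lambda>((rx, ry, rz), (\<theta>, \<phi>)). ry - rx * tan \<theta>)"

definition footprint_z :: "state \<Rightarrow> real" where
  "footprint_z = (\<lambda>((rx, ry, rz), (\<theta>, \<phi>)). rz - rx * (cot \<phi> / cos \<theta>))"

text \<open>First-order Taylor expansion of \<open>f\<close> at \<open>p\<close>, as a function of the increment \<open>e\<close>.\<close>

definition first_order :: "('a::real_normed_vector \<Rightarrow> real) \<Rightarrow> 'a \<Rightarrow> 'a \<Rightarrow> real" where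
  "first_order f p e = f p + frechet_derivative f (at p) e"

datatype coord = Cx | Cy | Cz | Ctheta | Cphi

definition state_of :: "(coord \<Rightarrow> real) \<Rightarrow> state" where
  "state_of s = ((s Cx, s Cy, s Cz), (s Ctheta, s Cphi))"

definition footprint_dist_first_order :: "state \<Rightarrow> state \<Rightarrow> real" where
  "footprint_dist_first_order p e =
     sqrt ((first_order footprint_y p e)\<^sup>2 + (first_order footprint_z p e)\<^sup>2)"

text \<open>Mean beam orientation under perfect tracking, for mean position \<open>(x, y, z)\<close>.\<close>

definition tracking_theta :: "real \<Rightarrow> real \<Rightarrow> real" where
  "tracking_theta x y = (if x > 0 then pi + arctan (y / x) else arctan (y / x))"

definition tracking_phi :: "real \<Rightarrow> real \<Rightarrow> real \<Rightarrow> real" where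
  "tracking_phi x y z = pi - arccos (z / sqrt (x\<^sup>2 + y\<^sup>2 + z\<^sup>2))"

definition footprint_cov :: "real \<Rightarrow> real \<Rightarrow> real \<Rightarrow> (coord \<Rightarrow> real) \<Rightarrow> real mat" where
  "footprint_cov \<mu>x \<mu>\<theta> \<mu>\<phi> \<sigma> =
     (let c1 = - tan \<mu>\<theta>;
          c2 = - (\<mu>x / (cos \<mu>\<theta>)\<^sup>2);
          c3 = \<mu>x / ((sin \<mu>\<phi>)\<^sup>2 * cos \<mu>\<theta>);
          c4 = - (\<mu>x * cot \<mu>\<phi> * tan \<mu>\<theta> / cos \<mu>\<theta>);
          c5 = - (cot \<mu>\<phi> / cos \<mu>\<theta>);
          s12 = c1 * c5 * (\<sigma> Cx)\<^sup>2 + c2 * c4 * (\<sigma> Ctheta)\<^sup>2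
      in mat_of_rows_list 2
           [[(\<sigma> Cy)\<^sup>2 + c1\<^sup>2 * (\<sigma> Cx)\<^sup>2 + c2\<^sup>2 * (\<sigma> Ctheta)\<^sup>2, s12],
            [s12, (\<sigma> Cz)\<^sup>2 + c3\<^sup>2 * (\<sigma> Cphi)\<^sup>2 + c4\<^sup>2 * (\<sigma> Ctheta)\<^sup>2 + c5\<^sup>2 * (\<sigma> Cx)\<^sup>2]])"


section \<open>Beam width and geometric loss\<close>

text \<open>
  In the following, \<open>wl\<close> is the optical wavelength, \<open>Cn2\<close> the index of refraction
  structure parameter (the symbol \<open>C\<^sub>n\<^sup>2\<close> as a whole, not to be squared again) and
  \<open>L\<close> the distance between drone and detector.
\<close>

definition coherence_length :: "real \<Rightarrow> real \<Rightarrow> real \<Rightarrow> real" where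
  "coherence_length Cn2 wl L = (0.55 * Cn2 * (2 * pi / wl)\<^sup>2 * L) powr (- 3 / 5)"

definition beam_width :: "real \<Rightarrow> real \<Rightarrow> real \<Rightarrow> real \<Rightarrow> real" where
  "beam_width w0 wl Cn2 L =
     w0 * sqrt (1 + (1 + 2 * w0\<^sup>2 / (coherence_length Cn2 wl L)\<^sup>2) * (wl * L / (pi * w0\<^sup>2))\<^sup>2)"

definition rho_y :: "real \<Rightarrow> real \<Rightarrow> real" where
  "rho_y \<theta> \<phi> = (cos \<phi>)\<^sup>2 + (sin \<phi>)\<^sup>2 * (cos \<theta>)\<^sup>2"

definition rho_z :: "real \<Rightarrow> real \<Rightarrow> real" where
  "rho_z \<theta> \<phi> = (sin \<phi>)\<^sup>2"

definition rho_yz :: "real \<Rightarrow> real \<Rightarrow> real" where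
  "rho_yz \<theta> \<phi> = - (cos \<phi> * sin \<phi> * sin \<theta>)"

definition rho_min :: "real \<Rightarrow> real \<Rightarrow> real" where
  "rho_min \<theta> \<phi> =
     2 / (rho_y \<theta> \<phi> + rho_z \<theta> \<phi> + sqrt ((rho_y \<theta> \<phi> - rho_z \<theta> \<phi>)\<^sup>2 + 4 * (rho_yz \<theta> \<phi>)\<^sup>2))"

definition rho_max :: "real \<Rightarrow> real \<Rightarrow> real" where
  "rho_max \<theta> \<phi> =
     2 / (rho_y \<theta> \<phi> + rho_z \<theta> \<phi> - sqrt ((rho_y \<theta> \<phi> - rho_z \<theta> \<phi>)\<^sup>2 + 4 * (rho_yz \<theta> \<phi>)\<^sup>2))"

text \<open>Here \<open>a\<close> is the detector radius, \<open>w\<close> the beam width and \<open>\<rho>\<close> one of the two values above.\<close>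

definition nu :: "real \<Rightarrow> real \<Rightarrow> real \<Rightarrow> real" where
  "nu a w \<rho> = a / w * sqrt (pi / (2 * \<rho>))"

definition k_coeff :: "real \<Rightarrow> real \<Rightarrow> real \<Rightarrow> real" where
  "k_coeff a w \<rho> =
     sqrt pi * \<rho> * erf (nu a w \<rho>) / (2 * nu a w \<rho> * exp (- (nu a w \<rho>)\<^sup>2))"

definition loss_A0 :: "real \<Rightarrow> real \<Rightarrow> real \<Rightarrow> real \<Rightarrow> real" where
  "loss_A0 a w \<theta> \<phi> = erf (nu a w (rho_min \<theta> \<phi>)) * erf (nu a w (rho_max \<theta> \<phi>))"

definition loss_k_mean :: "real \<Rightarrow> real \<Rightarrow> real \<Rightarrow> real \<Rightarrow> real" where
  "loss_k_mean a w \<theta> \<phi> = (k_coeff a w (rho_min \<theta> \<phi>) + k_coeff a w (rho_max \<theta> \<phi>)) / 2"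

definition geometric_loss :: "real \<Rightarrow> real \<Rightarrow> real \<Rightarrow> real \<Rightarrow> real" where
  "geometric_loss A0 k w u = A0 * exp (- (2 * u\<^sup>2 / (k * w\<^sup>2)))"

definition geometric_loss_density :: "real \<Rightarrow> real \<Rightarrow> real \<Rightarrow> real \<Rightarrow> real" where
  "geometric_loss_density A0 q varpi x =
     (if 0 \<le> x \<and> x \<le> A0
      then varpi / A0 * (x / A0) powr ((1 + q\<^sup>2) * varpi / (2 * q) - 1)
           * bessel_I 0 (- ((1 - q\<^sup>2) * varpi / (2 * q) * ln (x / A0)))
      else 0)"

end

(*
  To first order the footprint centre is an affine combination of the independent Gaussians, with
  constant term 0 by perfect tracking.  Starting from the pair of position errors (y, z), each further
  error adds a Gaussian multiple of a fixed vector, and completing the square shows that the pair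
  stays bivariate normal while its covariance matrix receives a rank-one update; the result is Sigma.

  The law of the distance follows by integrating the bivariate density over circles.  The angular
  integral is that of exp (A cos x + B sin x), namely 2 pi I_0 (sqrt (A^2 + B^2)), and A^2 + B^2
  depends on Sigma only through its trace and determinant, that is, through the eigenvalues; no
  diagonalization is needed.  The density of the loss is then a change of variables.
*)

theory Submission
  imports Defs
begin

section \<open>Integral representation of the Bessel function\<close>

text \<open>\<open>bessel_I\<close> is a power series, so its integral representation has to be
  derived: the exponential series is integrated term by term. On a circle the exponent of the
  Gaussian is a quadratic form in (cos, sin), hence a constant plus a multiple of the cosine and a
  multiple of the sine of the doubled angle. A half turn therefore covers a full period, which is
  why the slope of a line through the origin can replace the angle. The constant carries the trace,
  and A^2 + B^2 is proportional to trace^2 - 4 det, the squared difference of the eigenvalues.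

  The Gaussian part never meets a degenerate law: the starting covariance is diagonal with positive
  entries, and adding a nonnegative multiple of v v^T cannot lower the determinant. The factor split
  off by completing the square is the conditional density of the new error given the updated pair,
  so it integrates to 1.\<close>

lemma cos_power_integral_rec:
  assumes "((\<lambda>x. cos x ^ n) has_integral W) {-pi..pi::real}"
  shows "((\<lambda>x. cos x ^ (n + 2)) has_integral (real n + 1) / (real n + 2) * W) {-pi..pi}"
proof -
  \<comment> \<open>The antiderivative \<open>cos x ^ (n + 1) * sin x\<close> vanishes at both ends,
    and sin^2 = 1 - cos^2 turns its derivative into the two powers of the recursion.\<close>
  have "((\<lambda>x. (real n + 2) * cos x ^ (n + 2) - (real n + 1) * cos x ^ n) has_integral
          cos pi ^ (n + 1) * sin pi - cos (-pi) ^ (n + 1) * sin (-pi)) {-pi..pi}"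
  proof (rule fundamental_theorem_of_calculus)
    fix x :: real
    have "((\<lambda>x. cos x ^ (n + 1) * sin x) has_real_derivative
            - (real n + 1) * cos x ^ n * (sin x)\<^sup>2 + cos x ^ (n + 2)) (at x)"
      by (auto intro!: derivative_eq_intros simp: algebra_simps power2_eq_square simp del: power_Suc) (simp add: algebra_simps)
    also have "- (real n + 1) * cos x ^ n * (sin x)\<^sup>2 + cos x ^ (n + 2) =
        (real n + 2) * cos x ^ (n + 2) - (real n + 1) * cos x ^ n"
      unfolding sin_squared_eq by (simp add: algebra_simps power2_eq_square)
    finally show "((\<lambda>x. cos x ^ (n + 1) * sin x) has_vector_derivative
        (real n + 2) * cos x ^ (n + 2) - (real n + 1) * cos x ^ n) (at x within {-pi..pi})"
      using has_field_derivative_at_within has_real_derivative_iff_has_vector_derivative by blast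
  qed simp
  then have "((\<lambda>x. (real n + 2) * cos x ^ (n + 2) - (real n + 1) * cos x ^ n) has_integral 0) {-pi..pi}"
    by simp
  from has_integral_add[OF this has_integral_mult_right[OF assms, of "real n + 1"]]
  have "((\<lambda>x. (real n + 2) * cos x ^ (n + 2)) has_integral (real n + 1) * W) {-pi..pi}"
    by (simp add: algebra_simps)
  from has_integral_mult_right[OF this, of "1 / (real n + 2)"] show ?thesis
    by simp
qed

text \<open>Wallis' integrals. The central binomial coefficient is spelled out in factorials so that
  \<open>fact (2 * m)\<close> cancels against the coefficient of the exponential series and leaves
  the Bessel coefficient.\<close>

lemma has_integral_cos_power_even:
  "((\<lambda>x. cos x ^ (2 * m)) has_integral 2 * pi * fact (2 * m) / (4 ^ m * (fact m)\<^sup>2)) {-pi..pi::real}"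
proof (induction m)
  case 0
  show ?case using has_integral_const_real[of "1::real" "-pi" pi] by simp
next
  case (Suc m)
  have "fact (2 * Suc m) = (real (2 * m) + 2) * (real (2 * m) + 1) * (fact (2 * m) :: real)"
    by (simp add: algebra_simps)
  moreover have "4 ^ Suc m * (fact (Suc m))\<^sup>2 = (real (2 * m) + 2) * (real (2 * m) + 2) * (4 ^ m * (fact m)\<^sup>2 :: real)"
    by (simp add: algebra_simps power2_eq_square)
  ultimately have "2 * pi * fact (2 * Suc m) / (4 ^ Suc m * (fact (Suc m))\<^sup>2) =
      (real (2 * m) + 1) / (real (2 * m) + 2) * (2 * pi * fact (2 * m) / (4 ^ m * (fact m)\<^sup>2))"
    by (simp only: times_divide_times_eq) (simp add: divide_simps del: fact_Suc of_nat_mult)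
  with cos_power_integral_rec[OF Suc] show ?case by simp
qed

lemma has_integral_cos_power_odd:
  "((\<lambda>x. cos x ^ (2 * m + 1)) has_integral 0) {-pi..pi::real}"
proof (induction m)
  case 0
  have "(cos has_integral sin pi - sin (-pi)) {-pi..pi::real}"
    by (rule fundamental_theorem_of_calculus)
       (auto intro!: derivative_eq_intros simp flip: has_real_derivative_iff_has_vector_derivative)
  then show ?case by simp
next
  case (Suc m)
  from cos_power_integral_rec[OF Suc] show ?case by simp
qed

lemma bessel_I_0_sums: "(\<lambda>m. (x / 2) ^ (2 * m) / (fact m)\<^sup>2) sums bessel_I 0 x"
proof -
  have "summable (\<lambda>m. y ^ (2 * m) / (fact m)\<^sup>2)" for y :: real
  proof (rule summable_comparison_test')
    show "summable (\<lambda>m. (y\<^sup>2) ^ m /\<^sub>R fact m)" by (rule summable_exp_generic)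
    show "norm (y ^ (2 * m) / (fact m)\<^sup>2) \<le> (y\<^sup>2) ^ m /\<^sub>R fact m" for m
    proof -
      have "(y\<^sup>2) ^ m / (fact m)\<^sup>2 \<le> (y\<^sup>2) ^ m / fact m"
        by (intro divide_left_mono) (simp_all add: power2_eq_square)
      then show ?thesis by (simp add: power_mult divide_inverse_commute)
    qed
  qed
  then show ?thesis
    unfolding bessel_I_def by (simp add: summable_sums power2_eq_square)
qed

lemma bessel_I_0_minus: "bessel_I 0 (- x) = bessel_I 0 x"
  by (simp add: bessel_I_def power_mult)

lemma bessel_I_0_nonneg: "0 \<le> bessel_I 0 x"
  by (rule sums_le[OF _ sums_zero bessel_I_0_sums]) (simp add: power_mult)

lemma borel_measurable_bessel_I [measurable]: "bessel_I n \<in> borel_measurable borel"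
  unfolding bessel_I_def by measurable

text \<open>Since |cos| is at most 1, the exponential series converges uniformly and may be
  integrated termwise. Odd powers contribute 0, and the even ones are the terms of the series of
  \<open>bessel_I 0\<close>.\<close>

lemma has_integral_exp_cos:
  "((\<lambda>x. exp (\<kappa> * cos x)) has_integral 2 * pi * bessel_I 0 \<kappa>) {-pi..pi::real}"
proof -
  define f where "f n x = (\<kappa> * cos x) ^ n /\<^sub>R fact n" for n :: nat and x :: real
  have "uniform_limit {-pi..pi} (\<lambda>N x. \<Sum>n<N. f n x) (\<lambda>x. \<Sum>n. f n x) sequentially"
  proof (rule Weierstrass_m_test)
    show "summable (\<lambda>n. \<bar>\<kappa>\<bar> ^ n /\<^sub>R fact n)" by (rule summable_exp_generic)
    show "norm (f n x) \<le> \<bar>\<kappa>\<bar> ^ n /\<^sub>R fact n" for n x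
      unfolding f_def by (auto simp: abs_mult power_abs intro!: power_mono mult_left_le)
  qed
  also have "(\<lambda>x. \<Sum>n. f n x) = (\<lambda>x. exp (\<kappa> * cos x))"
    by (simp add: f_def exp_def)
  finally obtain I J where I: "\<And>N. ((\<lambda>x. \<Sum>n<N. f n x) has_integral I N) {-pi..pi}"
      and J: "((\<lambda>x. exp (\<kappa> * cos x)) has_integral J) {-pi..pi}" and lim: "I \<longlonglongrightarrow> J"
    by (rule uniform_limit_integral) (auto intro!: continuous_intros simp: f_def)
  define c where "c n = integral {-pi..pi} (f n)" for n
  have f_int: "(f n) integrable_on {-pi..pi}" for n
    unfolding f_def by (intro integrable_continuous_real continuous_intros)
  have "I = (\<lambda>N. \<Sum>n<N. c n)"
  proof
    fix N
    have "((\<lambda>x. \<Sum>n<N. f n x) has_integral (\<Sum>n<N. c n)) {-pi..pi}"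
      unfolding c_def by (intro has_integral_sum integrable_integral f_int) simp
    then show "I N = (\<Sum>n<N. c n)" using I has_integral_unique by blast
  qed
  then have "c sums J"
    using lim by (simp add: sums_def)
  have c_eq: "c n = \<kappa> ^ n / fact n * W" if "((\<lambda>x. cos x ^ n) has_integral W) {-pi..pi}" for n W
  proof -
    have "f n = (\<lambda>x. \<kappa> ^ n / fact n * cos x ^ n)"
      by (simp add: f_def fun_eq_iff power_mult_distrib divide_inverse_commute)
    then show ?thesis
      unfolding c_def using has_integral_mult_right[OF that] integral_unique by metis
  qed
  have even: "c (2 * m) = 2 * pi * ((\<kappa> / 2) ^ (2 * m) / (fact m)\<^sup>2)" for m
  proof -
    have "(2::real) ^ (2 * m) = 4 ^ m"
      by (simp add: power_mult)
    then show ?thesis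
      unfolding c_eq[OF has_integral_cos_power_even] by (simp add: power_divide)
  qed
  have odd: "c (2 * m + 1) = 0" for m
    unfolding c_eq[OF has_integral_cos_power_odd] by simp
  \<comment> \<open>All nonzero terms sit at even indices, so the sum may be reindexed along
    \<open>2 * m\<close>.\<close>
  have "c n = 0" if "n \<notin> range (\<lambda>m. 2 * m)" for n
  proof -
    have "odd n" using that by (auto elim!: evenE)
    then show ?thesis using odd by (metis oddE)
  qed
  moreover have "strict_mono (\<lambda>m::nat. 2 * m)"
    by (simp add: strict_mono_def)
  ultimately have "(\<lambda>m. c (2 * m)) sums J"
    using sums_mono_reindex[of "\<lambda>m. 2 * m" c J] \<open>c sums J\<close> by blast
  moreover have "(\<lambda>m. c (2 * m)) sums (2 * pi * bessel_I 0 \<kappa>)"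
    unfolding even by (intro sums_mult bessel_I_0_sums)
  ultimately have "J = 2 * pi * bessel_I 0 \<kappa>"
    using sums_unique2 by blast
  with J show ?thesis by simp
qed

lemma integral_period_shift:
  fixes g :: "real \<Rightarrow> real"
  assumes cont: "continuous_on UNIV g" and per: "\<And>x. g (x + (b - a)) = g x"
    and \<delta>: "0 \<le> \<delta>" "\<delta> \<le> b - a"
  shows "integral {a..b} (\<lambda>x. g (x - \<delta>)) = integral {a..b} g"
proof -
  have c: "continuous_on A g" for A using cont continuous_on_subset by blast
  have i: "g integrable_on {x..y}" for x y by (intro integrable_continuous_real c)
  have "integral {a..b} (\<lambda>x. g (x - \<delta>)) = integral {a - \<delta>..b - \<delta>} g"
    using integral_shift[of a "-\<delta>" b g] c by (simp add: o_def)
  \<comment> \<open>The bound on \<delta> keeps the cut point \<open>a\<close> inside the shifted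
    interval; the left piece is then moved by one period to the right end.\<close>
  also have "\<dots> = integral {a - \<delta>..a} g + integral {a..b - \<delta>} g"
    using \<delta> i by (intro Henstock_Kurzweil_Integration.integral_combine[symmetric]) auto
  also have "integral {a - \<delta>..a} g = integral {b - \<delta>..b} g"
    using integral_shift[of "a - \<delta>" "b - a" a g] c per by (simp add: o_def)
  also have "\<dots> + integral {a..b - \<delta>} g = integral {a..b} g"
    using \<delta> i by (subst add.commute, intro Henstock_Kurzweil_Integration.integral_combine) auto
  finally show ?thesis .
qed

text \<open>In polar form (A, B) = \<kappa> (cos \<delta>, sin \<delta>) the exponent is \<kappa>
  cos (x - \<delta>), and periodicity removes the phase.\<close>

lemma has_integral_exp_cos_sin:
  "((\<lambda>x. exp (A * cos x + B * sin x)) has_integral 2 * pi * bessel_I 0 (sqrt (A\<^sup>2 + B\<^sup>2))) {-pi..pi::real}"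
proof -
  define \<kappa> where "\<kappa> = sqrt (A\<^sup>2 + B\<^sup>2)"
  obtain \<delta> where \<delta>: "0 \<le> \<delta>" "\<delta> < 2 * pi" "A = \<kappa> * cos \<delta>" "B = \<kappa> * sin \<delta>"
  proof (cases "\<kappa> = 0")
    case True
    then have "A = 0" "B = 0" by (simp_all add: \<kappa>_def sum_power2_eq_zero_iff)
    with True show ?thesis by (intro that[of 0]) auto
  next
    case False
    have "(A / \<kappa>)\<^sup>2 + (B / \<kappa>)\<^sup>2 = 1"
      using False by (simp add: power_divide \<kappa>_def flip: add_divide_distrib)
    from sincos_total_2pi[OF this] False show ?thesis
      using that by (metis nonzero_divide_eq_eq mult.commute)
  qed
  have eq: "(\<lambda>x. exp (A * cos x + B * sin x)) = (\<lambda>x. exp (\<kappa> * cos (x - \<delta>)))"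
    by (simp add: \<delta>(3,4) cos_diff algebra_simps)
  have "integral {-pi..pi} (\<lambda>x. exp (\<kappa> * cos (x - \<delta>))) = integral {-pi..pi} (\<lambda>x. exp (\<kappa> * cos x))"
    using \<delta> by (intro integral_period_shift[where g = "\<lambda>x. exp (\<kappa> * cos x)"] continuous_intros) auto
  moreover have "(\<lambda>x. exp (\<kappa> * cos (x - \<delta>))) integrable_on {-pi..pi}"
    by (intro integrable_continuous_real continuous_intros)
  ultimately show ?thesis
    unfolding eq using has_integral_exp_cos[of \<kappa>]
    by (simp add: has_integral_iff \<kappa>_def)
qed

section \<open>Polar integration\<close>

lemma nn_integral_even:
  fixes f :: "real \<Rightarrow> ennreal"
  assumes [measurable]: "f \<in> borel_measurable borel" and even: "\<And>x. f (- x) = f x"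
  shows "(\<integral>\<^sup>+x. f x \<partial>lborel) = 2 * (\<integral>\<^sup>+x. f x * indicator {0<..} x \<partial>lborel)"
proof -
  have "(\<integral>\<^sup>+x. f x \<partial>lborel) = (\<integral>\<^sup>+x. f x * indicator {0<..} x + f x * indicator {..<0} x \<partial>lborel)"
    using AE_lborel_singleton[of 0] by (intro nn_integral_cong_AE) (auto split: split_indicator)
  also have "\<dots> = (\<integral>\<^sup>+x. f x * indicator {0<..} x \<partial>lborel) + (\<integral>\<^sup>+x. f x * indicator {..<0} x \<partial>lborel)"
    by (rule nn_integral_add) auto
  also have "(\<integral>\<^sup>+x. f x * indicator {..<0} x \<partial>lborel) = (\<integral>\<^sup>+x. f x * indicator {0<..} x \<partial>lborel)"
    by (subst nn_integral_real_affine[of _ "-1" 0])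
       (auto simp: even intro!: nn_integral_cong split: split_indicator)
  finally show ?thesis by (simp add: mult_2)
qed

text \<open>Polar coordinates, with the slope \<open>s = y / x\<close> in place of the angle, so that for fixed \<open>s\<close>
  or fixed \<open>x\<close> only linear substitutions occur.\<close>

lemma nn_integral_slope_polar:
  fixes f :: "real \<times> real \<Rightarrow> ennreal"
  assumes [measurable]: "f \<in> borel_measurable borel"
  shows "(\<integral>\<^sup>+x. \<integral>\<^sup>+y. f (x, y) \<partial>lborel \<partial>lborel) =
    (\<integral>\<^sup>+r. ennreal \<bar>r\<bar> * (\<integral>\<^sup>+s. f (r / sqrt (1 + s\<^sup>2), r * s / sqrt (1 + s\<^sup>2)) * ennreal (1 / (1 + s\<^sup>2)) \<partial>lborel) \<partial>lborel)"
proof -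
  have [measurable]: "f \<in> borel_measurable (borel \<Otimes>\<^sub>M borel)"
    by (simp add: borel_prod)
  have "(\<integral>\<^sup>+x. \<integral>\<^sup>+y. f (x, y) \<partial>lborel \<partial>lborel) = (\<integral>\<^sup>+x. \<integral>\<^sup>+s. ennreal \<bar>x\<bar> * f (x, x * s) \<partial>lborel \<partial>lborel)"
  proof (rule nn_integral_cong_AE, rule AE_mp[OF AE_lborel_singleton[of "0::real"]], intro AE_I2 impI)
    \<comment> \<open>The substitution y = x s needs x nonzero; the line x = 0 is a null
      set.\<close>
    fix x :: real assume "x \<noteq> 0"
    then show "(\<integral>\<^sup>+y. f (x, y) \<partial>lborel) = (\<integral>\<^sup>+s. ennreal \<bar>x\<bar> * f (x, x * s) \<partial>lborel)"
      by (subst nn_integral_real_affine[of _ x 0]) (auto simp: nn_integral_cmult)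
  qed
  also have "\<dots> = (\<integral>\<^sup>+s. \<integral>\<^sup>+x. ennreal \<bar>x\<bar> * f (x, x * s) \<partial>lborel \<partial>lborel)"
    by (rule lborel_pair.Fubini') (simp add: borel_prod[symmetric] split_beta')
  also have "\<dots> = (\<integral>\<^sup>+s. \<integral>\<^sup>+r. ennreal \<bar>r\<bar> * (f (r / sqrt (1 + s\<^sup>2), r * s / sqrt (1 + s\<^sup>2)) * ennreal (1 / (1 + s\<^sup>2))) \<partial>lborel \<partial>lborel)"
  proof (rule nn_integral_cong)
    fix s :: real
    \<comment> \<open>\<open>c\<close> is the cosine of the angle with slope \<open>s\<close>, so x
      = c r with r the signed distance to the origin. One factor \<open>c\<close> comes from dx, one
      from |x|; their product is the derivative of the angle with respect to the slope.\<close>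
    define c where "c = 1 / sqrt (1 + s\<^sup>2)"
    have pos: "0 < 1 + s\<^sup>2" by (simp add: add_pos_nonneg)
    then have c: "0 < c" "c * c = 1 / (1 + s\<^sup>2)" by (simp_all add: c_def)
    have "(\<integral>\<^sup>+x. ennreal \<bar>x\<bar> * f (x, x * s) \<partial>lborel) = ennreal \<bar>c\<bar> * (\<integral>\<^sup>+r. ennreal \<bar>0 + c * r\<bar> * f (0 + c * r, (0 + c * r) * s) \<partial>lborel)"
      using c by (intro nn_integral_real_affine) auto
    also have "\<dots> = (\<integral>\<^sup>+r. ennreal \<bar>c\<bar> * (ennreal \<bar>0 + c * r\<bar> * f (0 + c * r, (0 + c * r) * s)) \<partial>lborel)"
      by (rule nn_integral_cmult[symmetric]) auto
    also have "\<dots> = (\<integral>\<^sup>+r. ennreal \<bar>r\<bar> * (f (r / sqrt (1 + s\<^sup>2), r * s / sqrt (1 + s\<^sup>2)) * ennreal (1 / (1 + s\<^sup>2))) \<partial>lborel)"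
    proof (rule nn_integral_cong)
      fix r :: real
      have "ennreal \<bar>c\<bar> * ennreal \<bar>0 + c * r\<bar> = ennreal (\<bar>r\<bar> * (c * c))"
        using c(1) by (simp add: abs_mult ac_simps flip: ennreal_mult)
      also have "\<dots> = ennreal \<bar>r\<bar> * ennreal (1 / (1 + s\<^sup>2))"
        unfolding c(2) using pos by (intro ennreal_mult) auto
      finally have e: "ennreal \<bar>c\<bar> * ennreal \<bar>0 + c * r\<bar> = ennreal \<bar>r\<bar> * ennreal (1 / (1 + s\<^sup>2))" .
      have "ennreal \<bar>c\<bar> * (ennreal \<bar>0 + c * r\<bar> * f (0 + c * r, (0 + c * r) * s)) =
          (ennreal \<bar>c\<bar> * ennreal \<bar>0 + c * r\<bar>) * f (0 + c * r, (0 + c * r) * s)"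
        by (simp only: mult.assoc)
      also have "\<dots> = ennreal \<bar>r\<bar> * (f (r / sqrt (1 + s\<^sup>2), r * s / sqrt (1 + s\<^sup>2)) * ennreal (1 / (1 + s\<^sup>2)))"
        unfolding e by (simp add: c_def ac_simps)
      finally show "ennreal \<bar>c\<bar> * (ennreal \<bar>0 + c * r\<bar> * f (0 + c * r, (0 + c * r) * s)) =
          ennreal \<bar>r\<bar> * (f (r / sqrt (1 + s\<^sup>2), r * s / sqrt (1 + s\<^sup>2)) * ennreal (1 / (1 + s\<^sup>2)))" .
    qed
    finally show "(\<integral>\<^sup>+x. ennreal \<bar>x\<bar> * f (x, x * s) \<partial>lborel) =
        (\<integral>\<^sup>+r. ennreal \<bar>r\<bar> * (f (r / sqrt (1 + s\<^sup>2), r * s / sqrt (1 + s\<^sup>2)) * ennreal (1 / (1 + s\<^sup>2))) \<partial>lborel)" .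
  qed
  also have "\<dots> = (\<integral>\<^sup>+r. \<integral>\<^sup>+s. ennreal \<bar>r\<bar> * (f (r / sqrt (1 + s\<^sup>2), r * s / sqrt (1 + s\<^sup>2)) * ennreal (1 / (1 + s\<^sup>2))) \<partial>lborel \<partial>lborel)"
    by (rule lborel_pair.Fubini') (simp add: borel_prod[symmetric] split_beta')
  also have "\<dots> = (\<integral>\<^sup>+r. ennreal \<bar>r\<bar> * (\<integral>\<^sup>+s. f (r / sqrt (1 + s\<^sup>2), r * s / sqrt (1 + s\<^sup>2)) * ennreal (1 / (1 + s\<^sup>2)) \<partial>lborel) \<partial>lborel)"
    by (intro nn_integral_cong nn_integral_cmult) simp
  finally show ?thesis .
qed

text \<open>With s = tan x the two fractions are cos (2x) and sin (2x), and ds / (1 + s^2) = dx. As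
  x runs through (-pi/2, pi/2) the doubled angle makes one full turn, which gives half of the
  integral over {-pi..pi}.\<close>

lemma nn_integral_slope_bessel:
  "(\<integral>\<^sup>+s. ennreal (exp (A * ((1 - s\<^sup>2) / (1 + s\<^sup>2)) + B * (2 * s / (1 + s\<^sup>2))) / (1 + s\<^sup>2)) \<partial>lborel) =
    ennreal (pi * bessel_I 0 (sqrt (A\<^sup>2 + B\<^sup>2)))"
proof -
  define f where "f s = exp (A * ((1 - s\<^sup>2) / (1 + s\<^sup>2)) + B * (2 * s / (1 + s\<^sup>2))) / (1 + s\<^sup>2)" for s :: real
  define k where "k x = exp (A * cos (2 * x) + B * sin (2 * x))" for x :: real
  have pos: "0 < 1 + s\<^sup>2" for s :: real by (simp add: add_pos_nonneg)
  have k_int: "(k has_integral pi * bessel_I 0 (sqrt (A\<^sup>2 + B\<^sup>2))) {-pi/2..pi/2}"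
  proof -
    have img: "(\<lambda>x. x / 2) ` {-pi..pi} = {-pi/2..pi/2::real}"
      using image_divide_atLeastAtMost[of 2 "-pi" pi] by simp
    show ?thesis
      using has_integral_affinity[of "\<lambda>x. exp (A * cos x + B * sin x)" _ "-pi" pi 2 0, simplified,
          OF has_integral_exp_cos_sin]
      by (simp add: k_def[abs_def] img)
  qed
  have k_cont: "continuous_on X k" for X unfolding k_def by (intro continuous_intros)
  have k_set: "set_integrable lborel {-pi/2..pi/2} k"
    by (intro borel_integrable_atLeastAtMost' k_cont)
  have cos: "0 < cos x" if "-pi/2 < x" "x < pi/2" for x using that by (intro cos_gt_zero_pi) auto
  have fk: "f (tan x) * (1 + (tan x)\<^sup>2) = k x" if "-pi/2 < x" "x < pi/2" for x
  proof -
    note c = cos[OF that]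
    have "(1 - (tan x)\<^sup>2) / (1 + (tan x)\<^sup>2) = cos (2 * x)"
      using c sin_cos_squared_add[of x] by (simp add: tan_def cos_double power_divide divide_simps)
    moreover have "2 * tan x / (1 + (tan x)\<^sup>2) = sin (2 * x)"
    proof -
      have "1 + (tan x)\<^sup>2 = 1 / (cos x)\<^sup>2"
        using c tan_sec[of x] by (simp add: power_inverse divide_inverse)
      then show ?thesis using c by (simp add: tan_def sin_double power2_eq_square)
    qed
    ultimately show ?thesis
      using pos[of "tan x"] by (simp add: f_def k_def)
  qed
  \<comment> \<open>Integrability on the open interval is inherited from \<open>k\<close>, which is
    continuous on the closed one although \<open>tan\<close> is unbounded.\<close>
  have fk_set: "set_integrable lborel (einterval (ereal (-pi/2)) (ereal (pi/2))) (\<lambda>x. f (tan x) * (1 + (tan x)\<^sup>2))"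
  proof -
    have "set_integrable lborel {-pi/2<..<pi/2} k"
      by (rule set_integrable_subset[OF k_set]) auto
    also have "?this \<longleftrightarrow> set_integrable lborel {-pi/2<..<pi/2} (\<lambda>x. f (tan x) * (1 + (tan x)\<^sup>2))"
      by (intro set_integrable_cong) (auto simp: fk)
    finally show ?thesis by simp
  qed
  have d: "(tan has_real_derivative 1 + (tan x)\<^sup>2) (at x)" if "-pi/2 < x" "x < pi/2" for x
    using cos[OF that] by (subst tan_sec) (auto intro!: DERIV_tan simp: power_inverse)
  have d_cont: "isCont (\<lambda>x. 1 + (tan x)\<^sup>2) x" if "-pi/2 < x" "x < pi/2" for x
    using cos[OF that] by (intro continuous_intros) auto
  have f_cont: "isCont f s" for s
    unfolding f_def using pos[of s] by (intro continuous_intros) auto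
  note subst = interval_integral_substitution_nonneg[of "ereal (-pi/2)" "ereal (pi/2)" tan "\<lambda>x. 1 + (tan x)\<^sup>2" f "-\<infinity>" "\<infinity>"]
  have "set_integrable lborel (einterval (-\<infinity>) \<infinity>) f \<and>
      (LBINT x=-\<infinity>..\<infinity>. f x) = (LBINT x=ereal (-pi/2)..ereal (pi/2). f (tan x) * (1 + (tan x)\<^sup>2))"
    by (intro conjI subst)
       (use fk_set in \<open>auto simp: ereal_tendsto_simps filterlim_tan_at_left filterlim_tan_at_right
          d d_cont f_cont f_def pos less_imp_le\<close>)
  then have f_int: "integrable lborel f"
      and f_eq: "integral\<^sup>L lborel f = (LBINT x=ereal (-pi/2)..ereal (pi/2). f (tan x) * (1 + (tan x)\<^sup>2))"
    by (simp_all add: set_integrable_def interval_lebesgue_integral_def set_lebesgue_integral_def)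
  have "(LBINT x=ereal (-pi/2)..ereal (pi/2). f (tan x) * (1 + (tan x)\<^sup>2)) = (LBINT x=ereal (-pi/2)..ereal (pi/2). k x)"
    by (intro interval_integral_cong) (auto simp: fk min_def max_def)
  also have "\<dots> = integral {-pi/2..pi/2} k"
    using k_set by (intro interval_integral_eq_integral) auto
  also have "\<dots> = pi * bessel_I 0 (sqrt (A\<^sup>2 + B\<^sup>2))"
    using k_int by (rule integral_unique)
  finally have "integral\<^sup>L lborel f = pi * bessel_I 0 (sqrt (A\<^sup>2 + B\<^sup>2))"
    unfolding f_eq .
  then have "(\<integral>\<^sup>+s. ennreal (f s) \<partial>lborel) = ennreal (pi * bessel_I 0 (sqrt (A\<^sup>2 + B\<^sup>2)))"
    using nn_integral_eq_integral[OF f_int] pos by (simp add: f_def less_imp_le)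
  then show ?thesis unfolding f_def .
qed

section \<open>Bivariate normal distributions\<close>

text \<open>Density of the centred bivariate normal distribution with covariance matrix
  \<open>[[s11, s12], [s12, s22]]\<close>.\<close>

definition binormal_density :: "real \<Rightarrow> real \<Rightarrow> real \<Rightarrow> real \<times> real \<Rightarrow> real" where
  "binormal_density s11 s12 s22 = (\<lambda>(x, y).
     exp (- ((s22 * x\<^sup>2 - 2 * s12 * x * y + s11 * y\<^sup>2) / (2 * (s11 * s22 - s12\<^sup>2))))
       / (2 * pi * sqrt (s11 * s22 - s12\<^sup>2)))"

lemma borel_measurable_binormal_density [measurable]:
  "binormal_density s11 s12 s22 \<in> borel_measurable (borel \<Otimes>\<^sub>M borel)"
  unfolding binormal_density_def by measurable

lemma binormal_density_nonneg: "0 \<le> s11 * s22 - s12\<^sup>2 \<Longrightarrow> 0 \<le> binormal_density s11 s12 s22 z"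
  by (auto simp: binormal_density_def split: prod.split)

lemma binormal_density_uncorrelated:
  assumes "\<sigma> > 0" "\<tau> > 0"
  shows "binormal_density (\<sigma>\<^sup>2) 0 (\<tau>\<^sup>2) (x, y) = normal_density 0 \<sigma> x * normal_density 0 \<tau> y"
proof -
  have "sqrt (\<sigma>\<^sup>2 * \<tau>\<^sup>2) = \<sigma> * \<tau>" "sqrt (2 * pi * \<sigma>\<^sup>2) = sqrt (2 * pi) * \<sigma>" "sqrt (2 * pi * \<tau>\<^sup>2) = sqrt (2 * pi) * \<tau>"
    using assms by (simp_all add: real_sqrt_mult)
  moreover have "- ((\<tau>\<^sup>2 * x\<^sup>2 + \<sigma>\<^sup>2 * y\<^sup>2) / (2 * (\<sigma>\<^sup>2 * \<tau>\<^sup>2))) = - (x\<^sup>2 / (2 * \<sigma>\<^sup>2)) + - (y\<^sup>2 / (2 * \<tau>\<^sup>2))"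
    using assms by (simp add: field_simps)
  ultimately show ?thesis
    unfolding binormal_density_def normal_density_def using assms
    by (simp add: mult_exp_exp)
qed

text \<open>The determinant grows by t times the value at (a, b) of the adjugate form, which is
  nonnegative: multiplied by \<open>s11\<close> it is a sum of two squares with nonnegative
  weights.\<close>

lemma binormal_det_update_pos:
  fixes s11 s12 s22 a b t :: real
  assumes "0 < s11" "0 < s11 * s22 - s12\<^sup>2" "0 \<le> t"
  shows "0 < (s11 + a\<^sup>2 * t) * (s22 + b\<^sup>2 * t) - (s12 + a * b * t)\<^sup>2"
proof -
  have "0 \<le> s11 * (s22 * a\<^sup>2 - 2 * s12 * a * b + s11 * b\<^sup>2)"
  proof -
    have "s11 * (s22 * a\<^sup>2 - 2 * s12 * a * b + s11 * b\<^sup>2) = (s11 * s22 - s12\<^sup>2) * a\<^sup>2 + (s11 * b - s12 * a)\<^sup>2"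
      by (simp add: power2_eq_square algebra_simps)
    also have "\<dots> \<ge> 0" using assms by simp
    finally show ?thesis .
  qed
  then have "0 \<le> s22 * a\<^sup>2 - 2 * s12 * a * b + s11 * b\<^sup>2"
    using assms by (simp add: zero_le_mult_iff)
  then have "0 < (s11 * s22 - s12\<^sup>2) + t * (s22 * a\<^sup>2 - 2 * s12 * a * b + s11 * b\<^sup>2)"
    using assms by (intro add_pos_nonneg) auto
  then show ?thesis by (simp add: power2_eq_square algebra_simps)
qed

text \<open>Completing the square in \<open>t\<close>.\<close>

lemma binormal_density_shift:
  fixes s11 s12 s22 a b \<sigma> x y :: real
  defines "D \<equiv> s11 * s22 - s12\<^sup>2"
  defines "E \<equiv> D + \<sigma>\<^sup>2 * (s22 * a\<^sup>2 - 2 * s12 * a * b + s11 * b\<^sup>2)"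
  assumes "0 < D" "0 < E" "0 < \<sigma>"
  shows "binormal_density s11 s12 s22 (x - a * t, y - b * t) * normal_density 0 \<sigma> t =
    binormal_density (s11 + a\<^sup>2 * \<sigma>\<^sup>2) (s12 + a * b * \<sigma>\<^sup>2) (s22 + b\<^sup>2 * \<sigma>\<^sup>2) (x, y) *
    normal_density (\<sigma>\<^sup>2 * (s22 * a * x - s12 * (a * y + b * x) + s11 * b * y) / E) (\<sigma> * sqrt D / sqrt E) t"
proof -
  \<comment> \<open>Let B be the bilinear form of the adjugate of the covariance matrix, v = (a, b)
    and z = (x, y). Then P = B(v, v), Q = B(z, z) and R = B(v, z).\<close>
  define R where "R = s22 * a * x - s12 * (a * y + b * x) + s11 * b * y"
  define Q where "Q = s22 * x\<^sup>2 - 2 * s12 * x * y + s11 * y\<^sup>2"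
  define P where "P = s22 * a\<^sup>2 - 2 * s12 * a * b + s11 * b\<^sup>2"
  have E: "(s11 + a\<^sup>2 * \<sigma>\<^sup>2) * (s22 + b\<^sup>2 * \<sigma>\<^sup>2) - (s12 + a * b * \<sigma>\<^sup>2)\<^sup>2 = E"
    by (simp add: E_def D_def power2_eq_square algebra_simps)
  have EP: "E = D + \<sigma>\<^sup>2 * P" by (simp add: E_def P_def)
  have q1: "s22 * (x - a * t)\<^sup>2 - 2 * s12 * (x - a * t) * (y - b * t) + s11 * (y - b * t)\<^sup>2 = Q - 2 * R * t + P * t\<^sup>2"
    by (simp add: Q_def R_def P_def power2_eq_square algebra_simps)
  have q2: "(s22 + b\<^sup>2 * \<sigma>\<^sup>2) * x\<^sup>2 - 2 * (s12 + a * b * \<sigma>\<^sup>2) * x * y + (s11 + a\<^sup>2 * \<sigma>\<^sup>2) * y\<^sup>2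
      = Q + \<sigma>\<^sup>2 * (b * x - a * y)\<^sup>2"
    by (simp add: Q_def power2_eq_square algebra_simps)
  \<comment> \<open>The Gram determinant of v and z under a form of determinant D is D times the
    squared determinant of the matrix with columns v and z.\<close>
  have key: "P * Q - R\<^sup>2 = D * (b * x - a * y)\<^sup>2"
    by (simp add: P_def Q_def R_def D_def power2_eq_square algebra_simps)
  \<comment> \<open>On the right, \<sigma>^2 R / E and \<sigma>^2 D / E are the conditional mean and
    variance of the new error given the updated pair.\<close>
  have "(Q - 2 * R * t + P * t\<^sup>2) / (2 * D) + t\<^sup>2 / (2 * \<sigma>\<^sup>2) =
      (Q + \<sigma>\<^sup>2 * (b * x - a * y)\<^sup>2) / (2 * E) + (t - \<sigma>\<^sup>2 * R / E)\<^sup>2 / (2 * (\<sigma>\<^sup>2 * D / E))" (is "?l = ?r")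
  proof -
    have nz: "D \<noteq> 0" "E \<noteq> 0" "\<sigma>\<^sup>2 \<noteq> 0" using assms(3-5) by simp_all
    \<comment> \<open>Clearing denominators reduces the claim to a polynomial identity.
      \<open>S\<close> stands for \<sigma>^2 and \<open>k\<close> for the squared determinant, so
      that the Gram identity enters only through the replacement of \<open>D * k\<close>.\<close>
    have l: "((Q - 2 * R * t + P * t\<^sup>2) / (2 * D) + t\<^sup>2 / (2 * S)) * (2 * D * S * E) =
        (S * (Q - 2 * R * t + P * t\<^sup>2) + D * t\<^sup>2) * E" if "S \<noteq> 0" for S
      using nz(1,2) that by (simp add: field_simps)
    have r: "((Q + S * k) / (2 * E) + (t - S * R / E)\<^sup>2 / (2 * (S * D / E))) * (2 * D * S * E) =
        D * S * (Q + S * k) + (t * E - S * R)\<^sup>2" if "S \<noteq> 0" for S k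
      using nz(1,2) that by (simp add: field_simps power2_eq_square)
    have "(S * (Q - 2 * R * t + P * t\<^sup>2) + D * t\<^sup>2) * (D + S * P) =
        D * S * (Q + S * k) + (t * (D + S * P) - S * R)\<^sup>2" if "P * Q - R\<^sup>2 = D * k" for S k
    proof -
      have "D * S * (Q + S * k) = D * S * Q + S * S * (D * k)" by (simp add: algebra_simps)
      then show ?thesis unfolding that[symmetric] by (simp add: power2_eq_square algebra_simps)
    qed
    from this[OF key, of "\<sigma>\<^sup>2"]
    have "(\<sigma>\<^sup>2 * (Q - 2 * R * t + P * t\<^sup>2) + D * t\<^sup>2) * E =
        D * \<sigma>\<^sup>2 * (Q + \<sigma>\<^sup>2 * (b * x - a * y)\<^sup>2) + (t * E - \<sigma>\<^sup>2 * R)\<^sup>2"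
      unfolding EP .
    then have "?l * (2 * D * \<sigma>\<^sup>2 * E) = ?r * (2 * D * \<sigma>\<^sup>2 * E)"
      unfolding l[OF nz(3)] r[OF nz(3)] .
    then show ?thesis using nz by simp
  qed
  then have ex: "exp (- ((Q - 2 * R * t + P * t\<^sup>2) / (2 * D))) * exp (- t\<^sup>2 / (2 * \<sigma>\<^sup>2)) =
     exp (- ((Q + \<sigma>\<^sup>2 * (b * x - a * y)\<^sup>2) / (2 * E))) * exp (- (t - \<sigma>\<^sup>2 * R / E)\<^sup>2 / (2 * (\<sigma>\<^sup>2 * D / E)))"
    by (simp add: mult_exp_exp)
  have var: "(\<sigma> * sqrt D / sqrt E)\<^sup>2 = \<sigma>\<^sup>2 * D / E"
    using assms by (simp add: power_divide power_mult_distrib)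
  have "sqrt D * sqrt (2 * pi * \<sigma>\<^sup>2) = sqrt E * sqrt (2 * pi * (\<sigma>\<^sup>2 * D / E))"
    using assms by (simp flip: real_sqrt_mult)
  then show ?thesis
    unfolding binormal_density_def normal_density_def prod.case q1 q2 E D_def[symmetric] var R_def[symmetric]
    using ex \<open>0 < E\<close> by (simp add: divide_simps)
qed

section \<open>Adding an independent Gaussian to a bivariate normal pair\<close>

lemma (in prob_space) indep_var_distr_pair:
  assumes indep: "indep_var S X T Y" and f [measurable]: "f \<in> S \<rightarrow>\<^sub>M S'" and g [measurable]: "g \<in> T \<rightarrow>\<^sub>M T'"
  shows "distr M S' (\<lambda>\<omega>. f (X \<omega>)) \<Otimes>\<^sub>M distr M T' (\<lambda>\<omega>. g (Y \<omega>)) =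
    distr M (S' \<Otimes>\<^sub>M T') (\<lambda>\<omega>. (f (X \<omega>), g (Y \<omega>)))"
proof -
  have [measurable]: "X \<in> M \<rightarrow>\<^sub>M S" "Y \<in> M \<rightarrow>\<^sub>M T"
    and eq: "distr M S X \<Otimes>\<^sub>M distr M T Y = distr M (S \<Otimes>\<^sub>M T) (\<lambda>\<omega>. (X \<omega>, Y \<omega>))"
    using indep indep_var_distribution_eq by blast+
  interpret Y: prob_space "distr (distr M T Y) T' g" by (intro prob_space.prob_space_distr prob_space_distr) auto
  \<comment> \<open>Independence is wanted as an equality of a product of laws with a joint law, the
    premise of \<open>distributed_joint_indep'\<close>. It is pushed forward along \<open>f\<close>
    and \<open>g\<close> acting on separate coordinates.\<close>
  have "distr M S' (\<lambda>\<omega>. f (X \<omega>)) \<Otimes>\<^sub>M distr M T' (\<lambda>\<omega>. g (Y \<omega>)) =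
      distr (distr M S X) S' f \<Otimes>\<^sub>M distr (distr M T Y) T' g"
    by (simp add: distr_distr comp_def)
  also have "\<dots> = distr (distr M S X \<Otimes>\<^sub>M distr M T Y) (S' \<Otimes>\<^sub>M T') (\<lambda>(x, y). (f x, g y))"
    by (rule pair_measure_distr) (auto simp: Y.sigma_finite_measure_axioms)
  also have "\<dots> = distr M (S' \<Otimes>\<^sub>M T') (\<lambda>\<omega>. (f (X \<omega>), g (Y \<omega>)))"
    unfolding eq by (simp add: distr_distr comp_def)
  finally show ?thesis .
qed

text \<open>For a fixed value t of the new error the pair is merely translated by t (a, b). After
  exchanging the integrals, \<open>binormal_density_shift\<close> separates the new density from a
  normal density in t, which has mass 1. The positivity premises keep both covariance matrices
  nonsingular.\<close>

lemma (in prob_space) distributed_binormal_add_normal: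
  fixes X Y Z :: "'a \<Rightarrow> real"
  assumes XY: "distributed M (lborel \<Otimes>\<^sub>M lborel) (\<lambda>\<omega>. (X \<omega>, Y \<omega>)) (\<lambda>z. ennreal (binormal_density s11 s12 s22 z))"
    and Z: "distributed M lborel Z (\<lambda>t. ennreal (normal_density 0 \<sigma> t))"
    and indep: "distr M (lborel \<Otimes>\<^sub>M lborel) (\<lambda>\<omega>. (X \<omega>, Y \<omega>)) \<Otimes>\<^sub>M distr M lborel Z =
      distr M ((lborel \<Otimes>\<^sub>M lborel) \<Otimes>\<^sub>M lborel) (\<lambda>\<omega>. ((X \<omega>, Y \<omega>), Z \<omega>))"
    and pos: "0 < s11" "0 < s11 * s22 - s12\<^sup>2" "0 < \<sigma>"
  shows "distributed M (lborel \<Otimes>\<^sub>M lborel) (\<lambda>\<omega>. (X \<omega> + a * Z \<omega>, Y \<omega> + b * Z \<omega>))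
    (\<lambda>z. ennreal (binormal_density (s11 + a\<^sup>2 * \<sigma>\<^sup>2) (s12 + a * b * \<sigma>\<^sup>2) (s22 + b\<^sup>2 * \<sigma>\<^sup>2) z))"
    (is "distributed _ _ ?V (\<lambda>z. ennreal (?g z))")
proof -
  let ?f = "binormal_density s11 s12 s22"
  let ?L = "lborel \<Otimes>\<^sub>M lborel :: (real \<times> real) measure"
  have sets_eq: "sets (lborel \<Otimes>\<^sub>M lborel) = sets (borel \<Otimes>\<^sub>M borel :: (real \<times> real) measure)"
    by (intro sets_pair_measure_cong) auto
  have mXY [measurable]: "(\<lambda>\<omega>. (X \<omega>, Y \<omega>)) \<in> M \<rightarrow>\<^sub>M borel \<Otimes>\<^sub>M borel"
    using distributed_measurable[OF XY] measurable_cong_sets[OF refl sets_eq] by blast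
  have [measurable]: "X \<in> borel_measurable M" "Y \<in> borel_measurable M"
    using measurable_compose[OF mXY measurable_fst] measurable_compose[OF mXY measurable_snd] by simp_all
  have [measurable]: "Z \<in> borel_measurable M"
    using distributed_measurable[OF Z] by simp
  have sf: "sigma_finite_measure ?L" by (simp add: lborel_prod sigma_finite_lborel)
  interpret LL: pair_sigma_finite ?L "lborel :: real measure"
    by (intro pair_sigma_finite.intro sf sigma_finite_lborel)
  have joint: "distributed M (?L \<Otimes>\<^sub>M lborel) (\<lambda>\<omega>. ((X \<omega>, Y \<omega>), Z \<omega>))
      (\<lambda>(z, t). ennreal (?f z) * ennreal (normal_density 0 \<sigma> t))"
    by (rule distributed_joint_indep'[OF sf sigma_finite_lborel XY Z indep])
  have Epos: "0 < s11 * s22 - s12\<^sup>2 + \<sigma>\<^sup>2 * (s22 * a\<^sup>2 - 2 * s12 * a * b + s11 * b\<^sup>2)"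
    using binormal_det_update_pos[OF pos(1,2), where t = "\<sigma>\<^sup>2" and a = a and b = b] by (simp add: power2_eq_square algebra_simps)
  have f_nonneg: "0 \<le> ?f z" for z using pos by (intro binormal_density_nonneg) simp
  have "distr M ?L ?V = density ?L (\<lambda>z. ennreal (?g z))"
  proof (rule measure_eqI)
    fix A assume "A \<in> sets (distr M ?L ?V)"
    then have A [measurable]: "A \<in> sets (borel \<Otimes>\<^sub>M borel)" by (simp add: sets_eq)
    let ?i = "indicator A :: real \<times> real \<Rightarrow> ennreal"
    have "emeasure (distr M ?L ?V) A = (\<integral>\<^sup>+\<omega>. ?i (?V \<omega>) \<partial>M)"
      by (subst nn_integral_indicator[symmetric], simp add: sets_eq, subst nn_integral_distr)
         (simp_all add: sets_eq cong: measurable_cong_sets)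
    also have "\<dots> = (\<integral>\<^sup>+\<omega>. (\<lambda>((x, y), t). ?i (x + a * t, y + b * t)) ((X \<omega>, Y \<omega>), Z \<omega>) \<partial>M)"
      by simp
    also have "\<dots> = (\<integral>\<^sup>+w. (\<lambda>(z, t). ennreal (?f z) * ennreal (normal_density 0 \<sigma> t)) w *
        (\<lambda>((x, y), t). ?i (x + a * t, y + b * t)) w \<partial>(?L \<Otimes>\<^sub>M lborel))"
      by (rule distributed_nn_integral[OF joint, symmetric]) (simp add: sets_eq split_beta' cong: measurable_cong_sets)
    also have "\<dots> = (\<integral>\<^sup>+t. \<integral>\<^sup>+z. ennreal (?f z) * ennreal (normal_density 0 \<sigma> t) * ?i (fst z + a * t, snd z + b * t) \<partial>?L \<partial>lborel)"
      by (subst LL.nn_integral_snd[symmetric]) (simp_all add: split_beta')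
    also have "\<dots> = (\<integral>\<^sup>+t. \<integral>\<^sup>+z. ennreal (?f (fst z - a * t, snd z - b * t)) * ennreal (normal_density 0 \<sigma> t) * ?i z \<partial>?L \<partial>lborel)"
    proof (rule nn_integral_cong)
      fix t :: real
      \<comment> \<open>The integrand after translation; the factors \<open>1 *\<close> below keep
        the arguments in the affine form used by \<open>nn_integral_real_affine\<close>.\<close>
      let ?h = "\<lambda>x y. ennreal (?f (x - a * t, y - b * t)) * ennreal (normal_density 0 \<sigma> t) * ?i (x, y)"
      have "(\<integral>\<^sup>+z. ennreal (?f z) * ennreal (normal_density 0 \<sigma> t) * ?i (fst z + a * t, snd z + b * t) \<partial>?L) =
          (\<integral>\<^sup>+x. \<integral>\<^sup>+y. ?h (a * t + 1 * x) (b * t + 1 * y) \<partial>lborel \<partial>lborel)"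
        by (subst lborel.nn_integral_fst[symmetric]) (simp_all add: add.commute)
      also have "\<dots> = (\<integral>\<^sup>+x. \<integral>\<^sup>+y. ?h (a * t + 1 * x) y \<partial>lborel \<partial>lborel)"
      proof (rule nn_integral_cong)
        fix x :: real
        show "(\<integral>\<^sup>+y. ?h (a * t + 1 * x) (b * t + 1 * y) \<partial>lborel) = (\<integral>\<^sup>+y. ?h (a * t + 1 * x) y \<partial>lborel)"
          by (subst nn_integral_real_affine[of "?h (a * t + 1 * x)" 1 "b * t"]) simp_all
      qed
      also have "\<dots> = (\<integral>\<^sup>+x. \<integral>\<^sup>+y. ?h x y \<partial>lborel \<partial>lborel)"
        by (subst (2) nn_integral_real_affine[of _ 1 "a * t"]) simp_all
      also have "\<dots> = (\<integral>\<^sup>+z. ?h (fst z) (snd z) \<partial>?L)"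
        by (subst lborel.nn_integral_fst[symmetric]) simp_all
      finally show "(\<integral>\<^sup>+z. ennreal (?f z) * ennreal (normal_density 0 \<sigma> t) * ?i (fst z + a * t, snd z + b * t) \<partial>?L) =
          (\<integral>\<^sup>+z. ennreal (?f (fst z - a * t, snd z - b * t)) * ennreal (normal_density 0 \<sigma> t) * ?i z \<partial>?L)"
        by simp
    qed
    also have "\<dots> = (\<integral>\<^sup>+z. \<integral>\<^sup>+t. ennreal (?f (fst z - a * t, snd z - b * t)) * ennreal (normal_density 0 \<sigma> t) * ?i z \<partial>lborel \<partial>?L)"
      by (rule LL.Fubini') (simp add: split_beta')
    also have "\<dots> = (\<integral>\<^sup>+z. ennreal (?g z) * ?i z \<partial>?L)"
    proof (rule nn_integral_cong)
      fix z :: "real \<times> real"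
      \<comment> \<open>Conditional mean and standard deviation of the new error given that the
        updated pair equals \<open>z\<close>; the denominator is the updated determinant, positive
        by \<open>Epos\<close>.\<close>
      define m where "m = \<sigma>\<^sup>2 * (s22 * a * fst z - s12 * (a * snd z + b * fst z) + s11 * b * snd z) /
        (s11 * s22 - s12\<^sup>2 + \<sigma>\<^sup>2 * (s22 * a\<^sup>2 - 2 * s12 * a * b + s11 * b\<^sup>2))"
      define \<tau> where "\<tau> = \<sigma> * sqrt (s11 * s22 - s12\<^sup>2) /
        sqrt (s11 * s22 - s12\<^sup>2 + \<sigma>\<^sup>2 * (s22 * a\<^sup>2 - 2 * s12 * a * b + s11 * b\<^sup>2))"
      have "0 < \<tau>" using pos Epos by (simp add: \<tau>_def)
      have g_nonneg: "0 \<le> ?g z"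
        using binormal_det_update_pos[OF pos(1,2), where t = "\<sigma>\<^sup>2" and a = a and b = b] by (intro binormal_density_nonneg) simp
      have "ennreal (?f (fst z - a * t, snd z - b * t)) * ennreal (normal_density 0 \<sigma> t) * ?i z
          = (ennreal (?g z) * ?i z) * ennreal (normal_density m \<tau> t)" for t
        using binormal_density_shift[where ?s11.0 = s11 and ?s12.0 = s12 and ?s22.0 = s22 and \<sigma> = \<sigma> and a = a and b = b
            and x = "fst z" and y = "snd z" and t = t] pos Epos f_nonneg g_nonneg
        by (simp add: m_def \<tau>_def mult_ac flip: ennreal_mult)
      then have "(\<integral>\<^sup>+t. ennreal (?f (fst z - a * t, snd z - b * t)) * ennreal (normal_density 0 \<sigma> t) * ?i z \<partial>lborel)
          = ennreal (?g z) * ?i z * (\<integral>\<^sup>+t. ennreal (normal_density m \<tau> t) \<partial>lborel)"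
        by (simp add: nn_integral_cmult)
      also have "(\<integral>\<^sup>+t. ennreal (normal_density m \<tau> t) \<partial>lborel) = 1"
        using prob_space.emeasure_space_1[OF prob_space_normal_density[OF \<open>0 < \<tau>\<close>, of m]]
        by (simp add: emeasure_density)
      finally show "(\<integral>\<^sup>+t. ennreal (?f (fst z - a * t, snd z - b * t)) * ennreal (normal_density 0 \<sigma> t) * ?i z \<partial>lborel)
          = ennreal (?g z) * ?i z" by simp
    qed
    also have "\<dots> = emeasure (density ?L (\<lambda>z. ennreal (?g z))) A"
      by (subst emeasure_density) (simp_all add: sets_eq)
    finally show "emeasure (distr M ?L ?V) A = emeasure (density ?L (\<lambda>z. ennreal (?g z))) A" .
  qed simp
  then show ?thesis
    unfolding distributed_def by (simp add: sets_eq cong: measurable_cong_sets)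
qed

section \<open>From the bivariate normal density to the Hoyt law\<close>

lemma (in prob_space) distributed_hoyt:
  fixes X Y :: "'a \<Rightarrow> real"
  assumes XY: "distributed M (lborel \<Otimes>\<^sub>M lborel) (\<lambda>\<omega>. (X \<omega>, Y \<omega>)) (\<lambda>z. ennreal (binormal_density s11 s12 s22 z))"
    and pos: "0 < q" "0 < \<Omega>"
    and trace: "s11 + s22 = \<Omega>" and det: "s11 * s22 - s12\<^sup>2 = (q * \<Omega> / (1 + q\<^sup>2))\<^sup>2"
  shows "distributed M lborel (\<lambda>\<omega>. sqrt ((X \<omega>)\<^sup>2 + (Y \<omega>)\<^sup>2)) (\<lambda>t. ennreal (hoyt_density q \<Omega> t))"
proof -
  let ?f = "binormal_density s11 s12 s22"
  let ?L = "lborel \<Otimes>\<^sub>M lborel :: (real \<times> real) measure"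
  \<comment> \<open>\<open>d\<close> is the square root of the determinant of the covariance
    matrix.\<close>
  define d where "d = q * \<Omega> / (1 + q\<^sup>2)"
  have q1: "0 < 1 + q\<^sup>2" by (simp add: add_pos_nonneg)
  have d: "0 < d" using pos q1 by (simp add: d_def)
  have det': "s11 * s22 - s12\<^sup>2 = d\<^sup>2" using det by (simp add: d_def)
  have sets_eq: "sets (lborel \<Otimes>\<^sub>M lborel) = sets (borel \<Otimes>\<^sub>M borel :: (real \<times> real) measure)"
    by (intro sets_pair_measure_cong) auto
  have mXY [measurable]: "(\<lambda>\<omega>. (X \<omega>, Y \<omega>)) \<in> M \<rightarrow>\<^sub>M borel \<Otimes>\<^sub>M borel"
    using distributed_measurable[OF XY] measurable_cong_sets[OF refl sets_eq] by blast
  have [measurable]: "X \<in> borel_measurable M" "Y \<in> borel_measurable M"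
    using measurable_compose[OF mXY measurable_fst] measurable_compose[OF mXY measurable_snd] by simp_all
  have [measurable]: "?f \<in> borel_measurable borel" by (simp flip: borel_prod)
  have hoyt_m [measurable]: "hoyt_density q \<Omega> \<in> borel_measurable borel"
    unfolding hoyt_density_def by measurable
  have angular: "(\<integral>\<^sup>+s. ennreal (?f (r / sqrt (1 + s\<^sup>2), r * s / sqrt (1 + s\<^sup>2))) * ennreal (1 / (1 + s\<^sup>2)) \<partial>lborel) =
      ennreal (exp (- ((1 + q\<^sup>2)\<^sup>2 * r\<^sup>2 / (4 * q\<^sup>2 * \<Omega>))) / (2 * d) * bessel_I 0 ((1 - q ^ 4) * r\<^sup>2 / (4 * q\<^sup>2 * \<Omega>)))" for r
  proof -
    \<comment> \<open>With x = r cos p and y = r sin p the quadratic form is r^2 times trace/2 -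
      (s11 - s22)/2 cos (2p) - s12 sin (2p). Division by -2 d^2 yields \<open>A\<close>,
      \<open>B\<close> and the exponent in \<open>K\<close>.\<close>
    define A where "A = r\<^sup>2 / (4 * d\<^sup>2) * (s11 - s22)"
    define B where "B = r\<^sup>2 / (4 * d\<^sup>2) * (2 * s12)"
    define K where "K = exp (- (r\<^sup>2 / (4 * d\<^sup>2) * \<Omega>)) / (2 * pi * d)"
    have K: "0 \<le> K" using d by (simp add: K_def)
    have "?f (r / sqrt (1 + s\<^sup>2), r * s / sqrt (1 + s\<^sup>2)) * (1 / (1 + s\<^sup>2)) =
        K * (exp (A * ((1 - s\<^sup>2) / (1 + s\<^sup>2)) + B * (2 * s / (1 + s\<^sup>2))) / (1 + s\<^sup>2))" for s
    proof -
      have p: "0 < 1 + s\<^sup>2" by (simp add: add_pos_nonneg)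
      have "- ((s22 * (r / sqrt (1 + s\<^sup>2))\<^sup>2 - 2 * s12 * (r / sqrt (1 + s\<^sup>2)) * (r * s / sqrt (1 + s\<^sup>2)) + s11 * (r * s / sqrt (1 + s\<^sup>2))\<^sup>2) / (2 * d\<^sup>2))
          = - (r\<^sup>2 * (s22 - 2 * s12 * s + s11 * s\<^sup>2) / ((1 + s\<^sup>2) * (2 * d\<^sup>2)))"
      proof -
        have "(r / sqrt (1 + s\<^sup>2))\<^sup>2 = r\<^sup>2 / (1 + s\<^sup>2)" "(r * s / sqrt (1 + s\<^sup>2))\<^sup>2 = r\<^sup>2 * s\<^sup>2 / (1 + s\<^sup>2)"
          "2 * s12 * (r / sqrt (1 + s\<^sup>2)) * (r * s / sqrt (1 + s\<^sup>2)) = r\<^sup>2 * (2 * s12 * s) / (1 + s\<^sup>2)"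
          using p by (simp_all add: power_divide power_mult_distrib power2_eq_square)
        then show ?thesis
          by (simp only: times_divide_eq_right flip: add_divide_distrib diff_divide_distrib)
             (simp add: algebra_simps)
      qed
      also have "\<dots> = - (r\<^sup>2 / (4 * d\<^sup>2) * \<Omega>) + (A * ((1 - s\<^sup>2) / (1 + s\<^sup>2)) + B * (2 * s / (1 + s\<^sup>2)))"
        unfolding A_def B_def trace[symmetric] using d p by (simp add: divide_simps) (simp add: algebra_simps)
      finally have e: "- ((s22 * (r / sqrt (1 + s\<^sup>2))\<^sup>2 - 2 * s12 * (r / sqrt (1 + s\<^sup>2)) * (r * s / sqrt (1 + s\<^sup>2)) + s11 * (r * s / sqrt (1 + s\<^sup>2))\<^sup>2) / (2 * d\<^sup>2)) =
        - (r\<^sup>2 / (4 * d\<^sup>2) * \<Omega>) + (A * ((1 - s\<^sup>2) / (1 + s\<^sup>2)) + B * (2 * s / (1 + s\<^sup>2)))" .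
      show ?thesis
        unfolding binormal_density_def prod.case det' e exp_add[of "- (r\<^sup>2 / (4 * d\<^sup>2) * \<Omega>)"] K_def
        using d by simp
    qed
    then have "(\<integral>\<^sup>+s. ennreal (?f (r / sqrt (1 + s\<^sup>2), r * s / sqrt (1 + s\<^sup>2))) * ennreal (1 / (1 + s\<^sup>2)) \<partial>lborel) =
       (\<integral>\<^sup>+s. ennreal K * ennreal (exp (A * ((1 - s\<^sup>2) / (1 + s\<^sup>2)) + B * (2 * s / (1 + s\<^sup>2))) / (1 + s\<^sup>2)) \<partial>lborel)"
      using K binormal_density_nonneg[of s11 s22 s12] det'
      by (intro nn_integral_cong) (simp flip: ennreal_mult)
    also have "\<dots> = ennreal K * ennreal (pi * bessel_I 0 (sqrt (A\<^sup>2 + B\<^sup>2)))"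
      by (subst nn_integral_cmult) (simp_all only: nn_integral_slope_bessel, simp)
    also have "\<dots> = ennreal (exp (- (r\<^sup>2 / (4 * d\<^sup>2) * \<Omega>)) / (2 * d) * bessel_I 0 (sqrt (A\<^sup>2 + B\<^sup>2)))"
      using K bessel_I_0_nonneg by (simp add: K_def flip: ennreal_mult)
    also have "r\<^sup>2 / (4 * d\<^sup>2) * \<Omega> = (1 + q\<^sup>2)\<^sup>2 * r\<^sup>2 / (4 * q\<^sup>2 * \<Omega>)"
      using pos by (simp add: d_def power_divide power_mult_distrib power2_eq_square mult_ac)
    \<comment> \<open>Only 0 < q is assumed, so the root is an absolute value; the evenness of
      \<open>bessel_I 0\<close> removes it afterwards.\<close>
    also have "sqrt (A\<^sup>2 + B\<^sup>2) = \<bar>(1 - q ^ 4) * r\<^sup>2 / (4 * q\<^sup>2 * \<Omega>)\<bar>"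
    proof -
      have "A\<^sup>2 + B\<^sup>2 = (r\<^sup>2 / (4 * d\<^sup>2))\<^sup>2 * ((s11 + s22)\<^sup>2 - 4 * (s11 * s22 - s12\<^sup>2))"
      proof -
        have "(c * (s11 - s22))\<^sup>2 + (c * (2 * s12))\<^sup>2 = c\<^sup>2 * ((s11 + s22)\<^sup>2 - 4 * (s11 * s22 - s12\<^sup>2))" for c
          by (simp add: power2_eq_square algebra_simps)
        then show ?thesis unfolding A_def B_def .
      qed
      also have "\<dots> = (r\<^sup>2 / (4 * d\<^sup>2))\<^sup>2 * (\<Omega> * (1 - q\<^sup>2) / (1 + q\<^sup>2))\<^sup>2"
      proof -
        have "\<Omega>\<^sup>2 - 4 * d\<^sup>2 = (\<Omega>\<^sup>2 * (1 + q\<^sup>2)\<^sup>2 - 4 * (q * \<Omega>)\<^sup>2) / (1 + q\<^sup>2)\<^sup>2"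
          using q1 by (simp add: d_def power_divide diff_divide_distrib)
        also have "\<dots> = (\<Omega> * (1 - q\<^sup>2) / (1 + q\<^sup>2))\<^sup>2"
          by (simp add: power_divide) (simp add: power2_eq_square algebra_simps)
        finally show ?thesis by (simp add: trace det')
      qed
      also have "\<dots> = (r\<^sup>2 / (4 * d\<^sup>2) * (\<Omega> * (1 - q\<^sup>2) / (1 + q\<^sup>2)))\<^sup>2"
        by (simp only: power_mult_distrib)
      also have "r\<^sup>2 / (4 * d\<^sup>2) * (\<Omega> * (1 - q\<^sup>2) / (1 + q\<^sup>2)) = (1 - q\<^sup>2) * (1 + q\<^sup>2) * r\<^sup>2 / (4 * q\<^sup>2 * \<Omega>)"
        using pos q1 by (simp add: d_def power_divide divide_simps) (simp add: power2_eq_square)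
      also have "(1 - q\<^sup>2) * (1 + q\<^sup>2) = 1 - q ^ 4"
        by (simp add: algebra_simps flip: power_add)
      finally show ?thesis by simp
    qed
    also have "bessel_I 0 \<bar>(1 - q ^ 4) * r\<^sup>2 / (4 * q\<^sup>2 * \<Omega>)\<bar> = bessel_I 0 ((1 - q ^ 4) * r\<^sup>2 / (4 * q\<^sup>2 * \<Omega>))"
      by (simp add: abs_if bessel_I_0_minus del: minus_divide_left)
    finally show ?thesis .
  qed
  have "distr M lborel (\<lambda>\<omega>. sqrt ((X \<omega>)\<^sup>2 + (Y \<omega>)\<^sup>2)) = density lborel (\<lambda>t. ennreal (hoyt_density q \<Omega> t))"
  proof (rule measure_eqI)
    fix S assume "S \<in> sets (distr M lborel (\<lambda>\<omega>. sqrt ((X \<omega>)\<^sup>2 + (Y \<omega>)\<^sup>2)))"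
    then have [measurable]: "S \<in> sets borel" by simp
    let ?i = "indicator S :: real \<Rightarrow> ennreal"
    let ?H = "\<lambda>r. exp (- ((1 + q\<^sup>2)\<^sup>2 * r\<^sup>2 / (4 * q\<^sup>2 * \<Omega>))) / (2 * d) * bessel_I 0 ((1 - q ^ 4) * r\<^sup>2 / (4 * q\<^sup>2 * \<Omega>))"
    have "emeasure (distr M lborel (\<lambda>\<omega>. sqrt ((X \<omega>)\<^sup>2 + (Y \<omega>)\<^sup>2))) S = (\<integral>\<^sup>+\<omega>. ?i (sqrt ((X \<omega>)\<^sup>2 + (Y \<omega>)\<^sup>2)) \<partial>M)"
      by (subst nn_integral_indicator[symmetric], simp, subst nn_integral_distr) simp_all
    also have "\<dots> = (\<integral>\<^sup>+\<omega>. (\<lambda>z. ?i (sqrt ((fst z)\<^sup>2 + (snd z)\<^sup>2))) (X \<omega>, Y \<omega>) \<partial>M)"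
      by simp
    also have "\<dots> = (\<integral>\<^sup>+z. ennreal (?f z) * ?i (sqrt ((fst z)\<^sup>2 + (snd z)\<^sup>2)) \<partial>?L)"
      by (rule distributed_nn_integral[OF XY, symmetric]) (simp add: sets_eq cong: measurable_cong_sets)
    also have "\<dots> = (\<integral>\<^sup>+x. \<integral>\<^sup>+y. ennreal (?f (x, y)) * ?i (sqrt (x\<^sup>2 + y\<^sup>2)) \<partial>lborel \<partial>lborel)"
      by (subst lborel.nn_integral_fst[symmetric]) (simp_all add: sets_eq cong: measurable_cong_sets)
    also have "\<dots> = (\<integral>\<^sup>+r. ennreal \<bar>r\<bar> * (\<integral>\<^sup>+s. ennreal (?f (r / sqrt (1 + s\<^sup>2), r * s / sqrt (1 + s\<^sup>2))) *
        ?i (sqrt ((r / sqrt (1 + s\<^sup>2))\<^sup>2 + (r * s / sqrt (1 + s\<^sup>2))\<^sup>2)) * ennreal (1 / (1 + s\<^sup>2)) \<partial>lborel) \<partial>lborel)"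
      using nn_integral_slope_polar[of "\<lambda>z. ennreal (?f z) * ?i (sqrt ((fst z)\<^sup>2 + (snd z)\<^sup>2))"]
      by (simp flip: borel_prod)
    also have "\<dots> = (\<integral>\<^sup>+r. ennreal \<bar>r\<bar> * (?i \<bar>r\<bar> * ennreal (?H r)) \<partial>lborel)"
    proof (intro nn_integral_cong arg_cong2[where f = "(*)"] refl)
      fix r :: real
      have "(r / sqrt (1 + s\<^sup>2))\<^sup>2 + (r * s / sqrt (1 + s\<^sup>2))\<^sup>2 = r\<^sup>2" for s
      proof -
        have "0 < 1 + s\<^sup>2" by (simp add: add_pos_nonneg)
        then show ?thesis
          by (simp add: power_divide power_mult_distrib divide_simps) (simp add: algebra_simps)
      qed
      then have "(\<integral>\<^sup>+s. ennreal (?f (r / sqrt (1 + s\<^sup>2), r * s / sqrt (1 + s\<^sup>2))) *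
          ?i (sqrt ((r / sqrt (1 + s\<^sup>2))\<^sup>2 + (r * s / sqrt (1 + s\<^sup>2))\<^sup>2)) * ennreal (1 / (1 + s\<^sup>2)) \<partial>lborel) =
        (\<integral>\<^sup>+s. ?i \<bar>r\<bar> * (ennreal (?f (r / sqrt (1 + s\<^sup>2), r * s / sqrt (1 + s\<^sup>2))) * ennreal (1 / (1 + s\<^sup>2))) \<partial>lborel)"
        by (simp add: mult_ac)
      also have "\<dots> = ?i \<bar>r\<bar> * ennreal (?H r)"
        by (subst nn_integral_cmult) (simp_all only: angular, simp)
      finally show "(\<integral>\<^sup>+s. ennreal (?f (r / sqrt (1 + s\<^sup>2), r * s / sqrt (1 + s\<^sup>2))) *
          ?i (sqrt ((r / sqrt (1 + s\<^sup>2))\<^sup>2 + (r * s / sqrt (1 + s\<^sup>2))\<^sup>2)) * ennreal (1 / (1 + s\<^sup>2)) \<partial>lborel) =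
        ?i \<bar>r\<bar> * ennreal (?H r)" .
    qed
    \<comment> \<open>A slope together with a sign of r determines a ray, so positive and negative r
      account for the two half-planes. The resulting factor 2 cancels the one in
      \<open>2 * d\<close>, and 1 / d is the Hoyt prefactor.\<close>
    also have "\<dots> = 2 * (\<integral>\<^sup>+r. ennreal \<bar>r\<bar> * (?i \<bar>r\<bar> * ennreal (?H r)) * indicator {0<..} r \<partial>lborel)"
      by (rule nn_integral_even) simp_all
    also have "\<dots> = (\<integral>\<^sup>+r. 2 * (ennreal \<bar>r\<bar> * (?i \<bar>r\<bar> * ennreal (?H r)) * indicator {0<..} r) \<partial>lborel)"
      by (rule nn_integral_cmult[symmetric]) simp
    also have "\<dots> = (\<integral>\<^sup>+r. ennreal (hoyt_density q \<Omega> r) * ?i r \<partial>lborel)"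
    proof (intro nn_integral_cong)
      fix r :: real
      show "2 * (ennreal \<bar>r\<bar> * (?i \<bar>r\<bar> * ennreal (?H r)) * indicator {0<..} r) = ennreal (hoyt_density q \<Omega> r) * ?i r"
      proof (cases "r > 0")
        case True
        have H: "0 \<le> ?H r" using d bessel_I_0_nonneg by simp
        have "2 * (ennreal \<bar>r\<bar> * (?i \<bar>r\<bar> * ennreal (?H r)) * indicator {0<..} r) = ennreal 2 * ennreal r * ennreal (?H r) * ?i r"
          using True by (simp add: mult_ac)
        also have "ennreal 2 * ennreal r * ennreal (?H r) = ennreal (2 * r * ?H r)"
          using True H by (simp only: ennreal_mult mult_nonneg_nonneg zero_le_numeral less_imp_le)
        also have "2 * r * ?H r = hoyt_density q \<Omega> r"
          using True d by (simp add: hoyt_density_def d_def)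
        finally show ?thesis .
      next
        \<comment> \<open>At r = 0 the linear factor makes the Hoyt density vanish, so the open and
          the closed half-line agree.\<close>
        case False
        then show ?thesis by (auto simp: hoyt_density_def)
      qed
    qed
    also have "\<dots> = emeasure (density lborel (\<lambda>t. ennreal (hoyt_density q \<Omega> t))) S"
      by (subst emeasure_density) simp_all
    finally show "emeasure (distr M lborel (\<lambda>\<omega>. sqrt ((X \<omega>)\<^sup>2 + (Y \<omega>)\<^sup>2))) S =
      emeasure (density lborel (\<lambda>t. ennreal (hoyt_density q \<Omega> t))) S" .
  qed simp
  then show ?thesis
    unfolding distributed_def by simp
qed

section \<open>Transformation to the geometric loss\<close>

text \<open>Differentiability and injectivity are asked only on a set \<open>S\<close> outside which
  the density of \<open>X\<close> vanishes. The target density may be nonzero off the image on a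
  null set: this admits the value at \<open>A0\<close>, which the loss attains only at t =
  0.\<close>

lemma distributed_transform:
  fixes X :: "'a \<Rightarrow> real" and f g g' k :: "real \<Rightarrow> real"
  assumes X: "distributed M lborel X (\<lambda>x. ennreal (f x))"
    and prob: "prob_space M"
    and S [measurable]: "S \<in> sets borel" and f_nonneg: "\<And>x. 0 \<le> f x" and f_out: "\<And>x. x \<notin> S \<Longrightarrow> f x = 0"
    and g [measurable]: "g \<in> borel_measurable borel" and deriv: "\<And>x. x \<in> S \<Longrightarrow> (g has_real_derivative g' x) (at x)"
    and inj: "inj_on g S" and gS [measurable]: "g ` S \<in> sets borel"
    and k [measurable]: "k \<in> borel_measurable borel" and k_nonneg: "\<And>y. 0 \<le> k y"
    and fk: "\<And>x. x \<in> S \<Longrightarrow> f x = \<bar>g' x\<bar> * k (g x)" and k_out: "AE y in lborel. y \<notin> g ` S \<longrightarrow> k y = 0"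
  shows "distributed M lborel (\<lambda>\<omega>. g (X \<omega>)) (\<lambda>y. ennreal (k y))"
proof -
  interpret prob_space M by fact
  have [measurable]: "X \<in> borel_measurable M" using distributed_measurable[OF X] by simp
  have "(\<lambda>x. ennreal (f x)) \<in> borel_measurable borel" using distributed_borel_measurable[OF X] by simp
  from borel_measurable_enn2real[OF this] have f_m [measurable]: "f \<in> borel_measurable borel"
    using f_nonneg by simp
  have "(\<integral>\<^sup>+x. ennreal (f x) * 1 \<partial>lborel) = (\<integral>\<^sup>+\<omega>. 1 \<partial>M)"
    by (rule distributed_nn_integral[OF X]) simp
  then have f_int: "integrable lborel f"
    using f_nonneg by (intro integrableI_nonneg) (auto simp: emeasure_space_1)
  have "distr M lborel (\<lambda>\<omega>. g (X \<omega>)) = density lborel (\<lambda>y. ennreal (k y))"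
  proof (rule measure_eqI)
    fix B assume "B \<in> sets (distr M lborel (\<lambda>\<omega>. g (X \<omega>)))"
    then have B [measurable]: "B \<in> sets borel" by simp
    let ?i = "indicator B :: real \<Rightarrow> real"
    let ?F = "\<lambda>x. ?i (g x) * f x" and ?G = "\<lambda>y. ?i y * k y"
    have F_int: "integrable lborel ?F"
      by (rule Bochner_Integration.integrable_bound[OF f_int]) (auto simp: f_nonneg split: split_indicator)
    have F_S: "?F x = indicator S x *\<^sub>R ?F x" for x
      using f_out by (auto split: split_indicator)
    have F_set: "set_integrable lborel S ?F"
      unfolding set_integrable_def using F_int by (subst F_S[symmetric])
    have ev: "\<bar>g' x\<bar> * ?G (g x) = ?F x" if "x \<in> S" for x
      using fk[OF that] by simp
    \<comment> \<open>The change of variables theorem concerns the completed measure and the gauge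
      integral; these facts carry the statement over from \<open>lborel\<close>, and
      \<open>G_set\<close> carries the result back.\<close>
    have "?F absolutely_integrable_on S" "integral S ?F = integral\<^sup>L lborel ?F"
    proof -
      show "?F absolutely_integrable_on S"
        using F_set by (simp add: set_integrable_def integrable_completion)
      show "integral S ?F = integral\<^sup>L lborel ?F"
        using set_borel_integral_eq_integral(2)[OF F_set]
        unfolding set_lebesgue_integral_def by (simp only: F_S[symmetric])
    qed
    moreover have "(\<lambda>x. \<bar>g' x\<bar> * ?G (g x)) absolutely_integrable_on S \<longleftrightarrow> ?F absolutely_integrable_on S"
      by (intro set_integrable_cong refl ev)
    moreover have "integral S (\<lambda>x. \<bar>g' x\<bar> * ?G (g x)) = integral S ?F"
      by (intro Henstock_Kurzweil_Integration.integral_cong ev)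
    ultimately have "(\<lambda>x. \<bar>g' x\<bar> * ?G (g x)) absolutely_integrable_on S \<and>
        integral S (\<lambda>x. \<bar>g' x\<bar> * ?G (g x)) = integral\<^sup>L lborel ?F"
      by simp
    then have G: "?G absolutely_integrable_on (g ` S)" "integral (g ` S) ?G = integral\<^sup>L lborel ?F"
      using has_absolute_integral_change_of_variables_1'[of S g g' ?G "integral\<^sup>L lborel ?F"]
        deriv inj S by (auto intro: has_field_derivative_at_within)
    have G_set: "set_integrable lborel (g ` S) ?G"
      using G(1) unfolding set_integrable_def
      by (subst (asm) integrable_completion) auto
    have "(\<integral>\<^sup>+y. ennreal (?G y) \<partial>lborel) = (\<integral>\<^sup>+y. ennreal (indicator (g ` S) y *\<^sub>R ?G y) \<partial>lborel)"
      using k_out by (intro nn_integral_cong_AE) (auto split: split_indicator)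
    also have "\<dots> = ennreal (LINT y:(g ` S)|lborel. ?G y)"
      unfolding set_lebesgue_integral_def using G_set k_nonneg unfolding set_integrable_def
      by (intro nn_integral_eq_integral) auto
    also have "\<dots> = ennreal (integral\<^sup>L lborel ?F)"
      using set_borel_integral_eq_integral(2)[OF G_set] G(2) by simp
    also have "\<dots> = (\<integral>\<^sup>+x. ennreal (?F x) \<partial>lborel)"
      using F_int f_nonneg by (intro nn_integral_eq_integral[symmetric]) auto
    also have "\<dots> = (\<integral>\<^sup>+x. ennreal (f x) * indicator B (g x) \<partial>lborel)"
      by (intro nn_integral_cong) (simp split: split_indicator)
    also have "\<dots> = (\<integral>\<^sup>+\<omega>. indicator B (g (X \<omega>)) \<partial>M)"
      by (rule distributed_nn_integral[OF X]) simp
    also have "\<dots> = emeasure (distr M lborel (\<lambda>\<omega>. g (X \<omega>))) B"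
      by (subst nn_integral_indicator[symmetric], simp, subst nn_integral_distr) simp_all
    finally have "(\<integral>\<^sup>+y. ennreal (?G y) \<partial>lborel) = emeasure (distr M lborel (\<lambda>\<omega>. g (X \<omega>))) B" .
    moreover have "(\<integral>\<^sup>+y. ennreal (?G y) \<partial>lborel) = emeasure (density lborel (\<lambda>y. ennreal (k y))) B"
      by (subst emeasure_density) (auto intro!: nn_integral_cong split: split_indicator)
    ultimately show "emeasure (distr M lborel (\<lambda>\<omega>. g (X \<omega>))) B = emeasure (density lborel (\<lambda>y. ennreal (k y))) B"
      by simp
  qed simp
  then show ?thesis
    unfolding distributed_def by simp
qed

text \<open>The loss decreases strictly from \<open>A0\<close> to 0, and ln (x / A0) is a multiple
  of t^2. Hence a power of x / A0 becomes a Gaussian factor in t, and the Bessel argument becomes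
  quadratic in t; \<open>varpi\<close> is the constant that makes both agree with the Hoyt
  density.\<close>

lemma distributed_geometric_loss:
  assumes prob: "prob_space M" and u: "distributed M lborel u (\<lambda>t. ennreal (hoyt_density q \<Omega> t))"
    and pos: "0 < q" "0 < \<Omega>" "0 < A0" "0 < k" "0 < w"
    and varpi: "varpi = (1 + q\<^sup>2) * k * w\<^sup>2 / (4 * q * \<Omega>)"
  shows "distributed M lborel (\<lambda>\<omega>. geometric_loss A0 k w (u \<omega>)) (\<lambda>x. ennreal (geometric_loss_density A0 q varpi x))"
proof (rule distributed_transform[OF u prob, where S = "{0<..}" and
      g' = "\<lambda>t. - (4 * t / (k * w\<^sup>2)) * geometric_loss A0 k w t"])
  define c where "c = 2 / (k * w\<^sup>2)"
  have c: "0 < c" using pos by (simp add: c_def)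
  have g: "geometric_loss A0 k w t = A0 * exp (- (c * t\<^sup>2))" for t
    by (simp add: geometric_loss_def c_def)
  have varpi_pos: "0 < varpi" using pos by (simp add: varpi add_pos_nonneg)
  have img: "geometric_loss A0 k w ` {0<..} = {0<..<A0}"
  proof (intro equalityI subsetI)
    fix y assume "y \<in> {0<..<A0}"
    then have y: "0 < y" "y < A0" by auto
    have "ln (y / A0) < 0" using y pos by (simp add: ln_div)
    then have "0 < - ln (y / A0) / c" using c by (simp add: divide_neg_pos)
    moreover from this have "geometric_loss A0 k w (sqrt (- ln (y / A0) / c)) = y"
      using c y pos by (simp add: g)
    ultimately show "y \<in> geometric_loss A0 k w ` {0<..}"
      by (intro image_eqI[of _ _ "sqrt (- ln (y / A0) / c)"]) auto
  next
    fix y assume "y \<in> geometric_loss A0 k w ` {0<..}"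
    then show "y \<in> {0<..<A0}" using c pos by (auto simp: g)
  qed
  show "geometric_loss A0 k w ` {0<..} \<in> sets borel" unfolding img by simp
  show "inj_on (geometric_loss A0 k w) {0<..}"
    using c pos by (auto intro!: inj_onI simp: g)
  show "(geometric_loss A0 k w has_real_derivative - (4 * t / (k * w\<^sup>2)) * geometric_loss A0 k w t) (at t)" for t
    unfolding geometric_loss_def[abs_def] using pos
    by (auto intro!: derivative_eq_intros)
  show "geometric_loss A0 k w \<in> borel_measurable borel"
    unfolding geometric_loss_def[abs_def] by measurable
  show "geometric_loss_density A0 q varpi \<in> borel_measurable borel"
    unfolding geometric_loss_density_def[abs_def] by measurable
  show "0 \<le> geometric_loss_density A0 q varpi y" for y
    using varpi_pos pos bessel_I_0_nonneg by (simp add: geometric_loss_density_def)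
  show "0 \<le> hoyt_density q \<Omega> t" for t
    using pos bessel_I_0_nonneg by (simp add: hoyt_density_def add_nonneg_nonneg)
  show "hoyt_density q \<Omega> t = 0" if "t \<notin> {0<..}" for t
    using that by (auto simp: hoyt_density_def)
  \<comment> \<open>At y = 0 the convention that \<open>0 powr p\<close> is 0 gives the value 0, so
    only the point \<open>A0\<close> has to be discarded.\<close>
  show "AE y in lborel. y \<notin> geometric_loss A0 k w ` {0<..} \<longrightarrow> geometric_loss_density A0 q varpi y = 0"
    using AE_lborel_singleton[of A0] by eventually_elim (auto simp: img geometric_loss_density_def)
  show "hoyt_density q \<Omega> t = \<bar>- (4 * t / (k * w\<^sup>2)) * geometric_loss A0 k w t\<bar> *
      geometric_loss_density A0 q varpi (geometric_loss A0 k w t)" if "t \<in> {0<..}" for t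
  proof -
    have t: "0 < t" using that by simp
    let ?x = "geometric_loss A0 k w t" and ?p = "(1 + q\<^sup>2) * varpi / (2 * q)"
    have x: "0 < ?x" "?x \<le> A0" using pos c by (simp_all add: g)
    have ratio: "?x / A0 = exp (- (c * t\<^sup>2))" using pos by (simp add: g)
    have p: "c * t\<^sup>2 * ?p = (1 + q\<^sup>2)\<^sup>2 * t\<^sup>2 / (4 * q\<^sup>2 * \<Omega>)"
      using pos by (simp add: c_def varpi field_simps power2_eq_square)
    have arg: "- ((1 - q\<^sup>2) * varpi / (2 * q) * ln (?x / A0)) = (1 - q ^ 4) * t\<^sup>2 / (4 * q\<^sup>2 * \<Omega>)"
    proof -
      have "(1 - q ^ 4) = (1 - q\<^sup>2) * (1 + q\<^sup>2)"
        by (simp add: algebra_simps flip: power_add)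
      moreover have "(1 - q\<^sup>2) * varpi / (2 * q) * (c * t\<^sup>2) = (1 - q\<^sup>2) * (1 + q\<^sup>2) * t\<^sup>2 / (4 * q\<^sup>2 * \<Omega>)"
        using pos by (simp add: c_def varpi field_simps power2_eq_square)
      ultimately show ?thesis
        unfolding ratio by simp
    qed
    \<comment> \<open>The factor \<open>?x\<close> in the derivative of the loss compensates the -1
      in the exponent.\<close>
    have pw: "?x * (?x / A0) powr (?p - 1) = A0 * exp (- ((1 + q\<^sup>2)\<^sup>2 * t\<^sup>2 / (4 * q\<^sup>2 * \<Omega>)))"
    proof -
      have "?x * (?x / A0) powr (?p - 1) = A0 * ((?x / A0) powr 1 * (?x / A0) powr (?p - 1))"
        using x pos by simp
      also have "\<dots> = A0 * (?x / A0) powr ?p"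
        by (simp only: powr_add[symmetric]) simp
      also have "(?x / A0) powr ?p = exp (- (c * t\<^sup>2 * ?p))"
        unfolding ratio by (simp add: powr_def mult_ac)
      finally show ?thesis unfolding p .
    qed
    have "\<bar>- (4 * t / (k * w\<^sup>2)) * ?x\<bar> * geometric_loss_density A0 q varpi ?x =
        4 * t / (k * w\<^sup>2) * (varpi / A0) * (?x * (?x / A0) powr (?p - 1)) * bessel_I 0 ((1 - q ^ 4) * t\<^sup>2 / (4 * q\<^sup>2 * \<Omega>))"
      using x t pos unfolding geometric_loss_density_def arg by (simp add: abs_mult)
    also have "\<dots> = 4 * t / (k * w\<^sup>2) * varpi * exp (- ((1 + q\<^sup>2)\<^sup>2 * t\<^sup>2 / (4 * q\<^sup>2 * \<Omega>))) *
        bessel_I 0 ((1 - q ^ 4) * t\<^sup>2 / (4 * q\<^sup>2 * \<Omega>))"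
      unfolding pw using pos by simp
    also have "4 * t / (k * w\<^sup>2) * varpi = (1 + q\<^sup>2) * t / (q * \<Omega>)"
      unfolding varpi using pos by simp
    finally show ?thesis
      using t by (simp add: hoyt_density_def)
  qed
qed simp

section \<open>Beam footprint\<close>

lemma quadratic_roots_vieta:
  fixes l1 l2 t d :: real
  assumes "{l. l\<^sup>2 - t * l + d = 0} = {l1, l2}"
  shows "l1 + l2 = t" "l1 * l2 = d"
proof -
  have root: "l\<^sup>2 - t * l + d = 0 \<longleftrightarrow> l = l1 \<or> l = l2" for l
    using assms by (metis (mono_tags, lifting) insert_iff mem_Collect_eq singletonD)
  \<comment> \<open>The root set is invariant under the reflection of l to t - l. Every way in which
    this can permute or fix \<open>l1\<close> and \<open>l2\<close> gives the sum t, including the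
    double root, where the set {l1, l2} shows no multiplicity.\<close>
  have "(t - l)\<^sup>2 - t * (t - l) + d = l\<^sup>2 - t * l + d" for l
    by (simp add: power2_eq_square algebra_simps)
  then have "t - l1 = l1 \<or> t - l1 = l2" "t - l2 = l1 \<or> t - l2 = l2"
    using root by metis+
  then show "l1 + l2 = t" by linarith
  then have "d = l1 * l2"
    using root[of l1] by (auto simp: power2_eq_square algebra_simps)
  then show "l1 * l2 = d" by simp
qed

lemma eigenvalue_mat2:
  fixes a b c d l :: real
  shows "eigenvalue (mat_of_rows_list 2 [[a, b], [c, d]]) l \<longleftrightarrow> l\<^sup>2 - (a + d) * l + (a * d - b * c) = 0"
proof -
  let ?A = "mat_of_rows_list 2 [[a, b], [c, d]]"
  have A: "?A \<in> carrier_mat 2 2" by (rule carrier_matI) (simp_all add: mat_of_rows_list_def)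
  have "eigenvalue ?A l \<longleftrightarrow> Determinant.det (char_matrix ?A l) = 0"
    by (rule eigenvalue_det[OF A])
  also have "Determinant.det (char_matrix ?A l) = (a - l) * (d - l) - b * c"
  proof -
    let ?B = "char_matrix ?A l"
    have B: "?B \<in> carrier_mat 2 2" using A by simp
    have "mat_delete ?B i 0 \<in> carrier_mat 1 1" for i
      using mat_delete_carrier[OF B] by simp
    then have "Determinant.det ?B = ?B $$ (0, 0) * ?B $$ (1, 1) - ?B $$ (1, 0) * ?B $$ (0, 1)"
      using B by (subst laplace_expansion_column[OF B, of 0])
        (auto simp: cofactor_def det_single mat_delete_def numeral_2_eq_2 lessThan_Suc)
    also have "\<dots> = (a - l) * (d - l) - c * b"
      using A by (simp add: char_matrix_def mat_of_rows_list_def)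
    finally show ?thesis by simp
  qed
  finally show ?thesis by (simp add: power2_eq_square algebra_simps)
qed

section \<open>Geometry of perfect tracking\<close>

lemma cos_tan_tracking_theta:
  assumes "x \<noteq> 0"
  shows "cos (tracking_theta x y) = - x / sqrt (x\<^sup>2 + y\<^sup>2)" "tan (tracking_theta x y) = y / x"
proof -
  have "sqrt (1 + (y / x)\<^sup>2) = sqrt ((x\<^sup>2 + y\<^sup>2) / x\<^sup>2)"
    using assms by (simp add: power_divide add_divide_distrib)
  then have "sqrt (1 + (y / x)\<^sup>2) = sqrt (x\<^sup>2 + y\<^sup>2) / \<bar>x\<bar>"
    by (simp add: real_sqrt_divide)
  \<comment> \<open>The added pi for x > 0 makes the cosine opposite in sign to x on both sides of
    the detector plane, so that the beam points back to it.\<close>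
  then show "cos (tracking_theta x y) = - x / sqrt (x\<^sup>2 + y\<^sup>2)"
    using assms by (auto simp: tracking_theta_def cos_arctan cos_add)
  show "tan (tracking_theta x y) = y / x"
    by (simp add: tracking_theta_def tan_arctan add.commute[of pi])
qed

text \<open>The mean beam direction is the negative of the normalized position, and the sine of its
  polar angle is positive because the source is off the plane x = 0.\<close>

lemma sin_cot_tracking_phi:
  assumes "x \<noteq> 0"
  shows "0 < sin (tracking_phi x y z)" "cot (tracking_phi x y z) = - z / sqrt (x\<^sup>2 + y\<^sup>2)"
proof -
  define R where "R = x\<^sup>2 + y\<^sup>2 + z\<^sup>2"
  have xy: "0 < x\<^sup>2 + y\<^sup>2" using assms by (simp add: add_pos_nonneg)
  then have R: "0 < R" by (simp add: R_def add_pos_nonneg)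
  have "z\<^sup>2 \<le> R" using xy by (simp add: R_def)
  then have "\<bar>z\<bar> \<le> sqrt R" by (simp add: real_le_rsqrt)
  then have le: "\<bar>z / sqrt R\<bar> \<le> 1" using R by (simp add: abs_divide)
  have cos: "cos (tracking_phi x y z) = - z / sqrt R"
    using cos_arccos_abs[OF le] by (simp add: tracking_phi_def R_def cos_diff)
  have "sin (tracking_phi x y z) = sqrt (1 - (z / sqrt R)\<^sup>2)"
    using sin_arccos_abs[OF le] by (simp add: tracking_phi_def R_def sin_diff)
  also have "1 - (z / sqrt R)\<^sup>2 = (x\<^sup>2 + y\<^sup>2) / R"
    using R by (simp add: power_divide divide_simps) (simp add: R_def)
  finally have sin: "sin (tracking_phi x y z) = sqrt (x\<^sup>2 + y\<^sup>2) / sqrt R"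
    by (simp add: real_sqrt_divide)
  show "0 < sin (tracking_phi x y z)" using sin xy R by simp
  show "cot (tracking_phi x y z) = - z / sqrt (x\<^sup>2 + y\<^sup>2)"
    using R by (simp add: cot_def sin cos)
qed

text \<open>tan \<theta> = y / x and cot \<phi> / cos \<theta> = z / x, so both footprint
  coordinates cancel.\<close>

lemma footprint_tracking_eq_0:
  assumes "x \<noteq> 0"
  shows "footprint_y ((x, y, z), (tracking_theta x y, tracking_phi x y z)) = 0"
    "footprint_z ((x, y, z), (tracking_theta x y, tracking_phi x y z)) = 0"
proof -
  have "0 < sqrt (x\<^sup>2 + y\<^sup>2)" using assms by (simp add: add_pos_nonneg)
  then show "footprint_y ((x, y, z), (tracking_theta x y, tracking_phi x y z)) = 0"
    "footprint_z ((x, y, z), (tracking_theta x y, tracking_phi x y z)) = 0"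
    using assms by (simp_all add: footprint_y_def footprint_z_def cos_tan_tracking_theta sin_cot_tracking_phi)
qed

section \<open>Linearization of the footprint\<close>

lemma first_order_footprint_y:
  assumes "cos \<theta> \<noteq> 0"
  shows "first_order footprint_y ((x, y, z), (\<theta>, \<phi>)) ((ex, ey, ez), (et, ep)) =
    footprint_y ((x, y, z), (\<theta>, \<phi>)) + (ey - tan \<theta> * ex - x / (cos \<theta>)\<^sup>2 * et)"
proof -
  \<comment> \<open>Projections replace the tuple pattern so that the differentiation rules
    apply.\<close>
  have eq: "footprint_y = (\<lambda>p. fst (snd (fst p)) - fst (fst p) * tan (fst (snd p)))"
    by (auto simp: footprint_y_def fun_eq_iff)
  have "(footprint_y has_derivative
      (\<lambda>e. fst (snd (fst e)) - (fst (fst e) * tan \<theta> + x * (fst (snd e) * inverse ((cos \<theta>)\<^sup>2)))))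
      (at ((x, y, z), (\<theta>, \<phi>)))"
    unfolding eq using assms by (auto intro!: derivative_eq_intros simp: algebra_simps)
  then have "frechet_derivative footprint_y (at ((x, y, z), (\<theta>, \<phi>))) =
      (\<lambda>e. fst (snd (fst e)) - (fst (fst e) * tan \<theta> + x * (fst (snd e) * inverse ((cos \<theta>)\<^sup>2))))"
    by (rule frechet_derivative_at[symmetric])
  then show ?thesis by (simp add: first_order_def divide_inverse algebra_simps)
qed

text \<open>The coefficients of the increments are the entries c5, c4 and c3 from which
  \<open>footprint_cov\<close> is built.\<close>

lemma first_order_footprint_z:
  assumes "cos \<theta> \<noteq> 0" "sin \<phi> \<noteq> 0"
  shows "first_order footprint_z ((x, y, z), (\<theta>, \<phi>)) ((ex, ey, ez), (et, ep)) =
    footprint_z ((x, y, z), (\<theta>, \<phi>)) +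
    (ez - cot \<phi> / cos \<theta> * ex - x * cot \<phi> * tan \<theta> / cos \<theta> * et + x / ((sin \<phi>)\<^sup>2 * cos \<theta>) * ep)"
proof -
  let ?D = "\<lambda>e :: state. snd (snd (fst e)) - cot \<phi> / cos \<theta> * fst (fst e)
      - x * cot \<phi> * tan \<theta> / cos \<theta> * fst (snd e) + x / ((sin \<phi>)\<^sup>2 * cos \<theta>) * snd (snd e)"
  have eq: "footprint_z = (\<lambda>p. snd (snd (fst p)) - fst (fst p) * (cot (snd (snd p)) / cos (fst (snd p))))"
    by (auto simp: footprint_z_def fun_eq_iff)
  \<comment> \<open>The chain rule for \<open>cot\<close> after a projection, made available to the
    automatic differentiation below.\<close>
  have [derivative_intros]: "((\<lambda>p :: state. cot (snd (snd p))) has_derivative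
      (\<lambda>e. snd (snd e) * - inverse ((sin \<phi>)\<^sup>2))) (at ((x, y, z), (\<theta>, \<phi>)))"
    using assms
    by (intro DERIV_compose_FDERIV[where g = "\<lambda>p :: state. snd (snd p)" and f = cot])
       (auto intro!: derivative_eq_intros DERIV_cot)
  have "(footprint_z has_derivative ?D) (at ((x, y, z), (\<theta>, \<phi>)))"
    unfolding eq using assms
    by (auto intro!: derivative_eq_intros simp: fun_eq_iff tan_def field_simps power2_eq_square)
  then have "frechet_derivative footprint_z (at ((x, y, z), (\<theta>, \<phi>))) = ?D"
    by (rule frechet_derivative_at[symmetric])
  then show ?thesis by (simp add: first_order_def)
qed

section \<open>Positivity of the loss constants\<close>

lemma erf_pos:
  assumes "0 < x"
  shows "0 < erf x"
proof -
  have int: "(\<lambda>t. exp (- t\<^sup>2)) integrable_on {-x..x::real}"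
    by (intro integrable_continuous_real continuous_intros)
  have "(LBINT t=ereal (-x)..ereal x. exp (- t\<^sup>2)) = integral {-x..x} (\<lambda>t. exp (- t\<^sup>2))"
    using assms by (intro interval_integral_eq_integral borel_integrable_atLeastAtMost' continuous_intros) auto
  also have "\<dots> > 0"
  proof -
    have "(\<lambda>t. exp (- x\<^sup>2)) integrable_on {-x..x}" by (rule integrable_const_ivl)
    moreover have "exp (- x\<^sup>2) \<le> exp (- t\<^sup>2)" if "t \<in> {-x..x}" for t
      using that assms by (auto simp: abs_le_square_iff[symmetric] abs_le_iff)
    ultimately have "integral {-x..x} (\<lambda>t. exp (- x\<^sup>2)) \<le> integral {-x..x} (\<lambda>t. exp (- t\<^sup>2))"
      using int by (intro integral_le) auto
    moreover have "0 < integral {-x..x} (\<lambda>t. exp (- x\<^sup>2))" using assms by simp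
    ultimately show ?thesis by linarith
  qed
  finally show ?thesis by (simp add: erf_def)
qed

text \<open>\<open>rho_min\<close> and \<open>rho_max\<close> are the reciprocals of the eigenvalues
  of the symmetric matrix with diagonal \<open>rho_y\<close>, \<open>rho_z\<close> and off-diagonal
  entry \<open>rho_yz\<close>. Its determinant is sin^2 \<phi> cos^2 \<theta>, so it is positive
  definite.\<close>

lemma rho_pos:
  assumes "cos \<theta> \<noteq> 0" "sin \<phi> \<noteq> 0"
  shows "0 < rho_min \<theta> \<phi>" "0 < rho_max \<theta> \<phi>"
proof -
  let ?y = "rho_y \<theta> \<phi>" and ?z = "rho_z \<theta> \<phi>" and ?yz = "rho_yz \<theta> \<phi>"
  have z: "0 < ?z" using assms by (simp add: rho_z_def)
  have y: "0 < ?y" using assms by (simp add: rho_y_def add_nonneg_pos)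
  have "?y * ?z - ?yz\<^sup>2 = (sin \<phi>)\<^sup>2 * (cos \<theta>)\<^sup>2"
  proof -
    have "?y * ?z - ?yz\<^sup>2 = (sin \<phi>)\<^sup>2 * ((cos \<phi>)\<^sup>2 * (1 - (sin \<theta>)\<^sup>2) + (sin \<phi>)\<^sup>2 * (cos \<theta>)\<^sup>2)"
      by (simp add: rho_y_def rho_z_def rho_yz_def power2_eq_square algebra_simps)
    also have "(cos \<phi>)\<^sup>2 * (1 - (sin \<theta>)\<^sup>2) + (sin \<phi>)\<^sup>2 * (cos \<theta>)\<^sup>2 = ((cos \<phi>)\<^sup>2 + (sin \<phi>)\<^sup>2) * (cos \<theta>)\<^sup>2"
      by (simp only: cos_squared_eq[of \<theta>] distrib_right)
    finally show ?thesis by simp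
  qed
  also have "0 < \<dots>" using assms by simp
  \<comment> \<open>The two sides differ by four times the determinant.\<close>
  finally have "(?y - ?z)\<^sup>2 + 4 * ?yz\<^sup>2 < (?y + ?z)\<^sup>2"
    by (simp add: power2_eq_square algebra_simps)
  then have lt: "sqrt ((?y - ?z)\<^sup>2 + 4 * ?yz\<^sup>2) < ?y + ?z"
    using y z by (intro real_less_lsqrt) auto
  then show "0 < rho_max \<theta> \<phi>" by (simp add: rho_max_def)
  show "0 < rho_min \<theta> \<phi>" using y z by (simp add: rho_min_def add_pos_nonneg)
qed

lemma nu_pos: "0 < a \<Longrightarrow> 0 < w \<Longrightarrow> 0 < \<rho> \<Longrightarrow> 0 < nu a w \<rho>"
  by (simp add: nu_def)

lemma loss_constants_pos:
  assumes "0 < a" "0 < w" "cos \<theta> \<noteq> 0" "sin \<phi> \<noteq> 0"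
  shows "0 < loss_A0 a w \<theta> \<phi>" "0 < loss_k_mean a w \<theta> \<phi>"
proof -
  note \<rho> = rho_pos[OF assms(3,4)]
  have k: "0 < k_coeff a w \<rho>" if "0 < \<rho>" for \<rho>
    using that nu_pos[OF assms(1,2) that] erf_pos[OF nu_pos[OF assms(1,2) that]] by (simp add: k_coeff_def)
  show "0 < loss_A0 a w \<theta> \<phi>"
    unfolding loss_A0_def by (intro mult_pos_pos erf_pos nu_pos assms \<rho>)
  show "0 < loss_k_mean a w \<theta> \<phi>"
    unfolding loss_k_mean_def using k[OF \<rho>(1)] k[OF \<rho>(2)] by simp
qed

lemma beam_width_pos: "0 < w0 \<Longrightarrow> 0 < beam_width w0 wl Cn2 L"
  by (auto simp: beam_width_def intro!: mult_pos_pos add_pos_nonneg mult_nonneg_nonneg add_nonneg_nonneg)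

section \<open>Assembly of the joint law and the final distributions\<close>

lemma (in prob_space) indep_vars_distr_pair:
  fixes X :: "'i \<Rightarrow> 'a \<Rightarrow> real"
  assumes indep: "indep_vars (\<lambda>_. borel) X UNIV" and s: "s \<notin> J"
    and F: "F \<in> (\<Pi>\<^sub>M i\<in>J. borel) \<rightarrow>\<^sub>M S"
  shows "distr M S (\<lambda>\<omega>. F (\<lambda>i\<in>J. X i \<omega>)) \<Otimes>\<^sub>M distr M lborel (X s) =
    distr M (S \<Otimes>\<^sub>M lborel) (\<lambda>\<omega>. (F (\<lambda>i\<in>J. X i \<omega>), X s \<omega>))"
proof -
  \<comment> \<open>\<open>J\<close> collects the errors already absorbed into the pair
    \<open>F\<close>, and \<open>s\<close> is the next one; disjoint index sets give independent
    subfamilies.\<close>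
  have "indep_var (\<Pi>\<^sub>M i\<in>J. borel) (\<lambda>\<omega>. \<lambda>i\<in>J. X i \<omega>) (\<Pi>\<^sub>M i\<in>{s}. borel) (\<lambda>\<omega>. \<lambda>i\<in>{s}. X i \<omega>)"
    using s by (intro indep_var_restrict[OF indep]) auto
  from indep_var_distr_pair[OF this F, of "\<lambda>e. e s" lborel] show ?thesis
    by simp
qed

theorem mainTheorem3:
  fixes M :: "'s measure"
    and \<epsilon> :: "coord \<Rightarrow> 's \<Rightarrow> real"
    and \<sigma> :: "coord \<Rightarrow> real"
    and \<mu>x \<mu>y \<mu>z \<mu>\<theta> \<mu>\<phi> :: real
    and a w0 wl Cn2 w :: real
    and l1 l2 q \<Omega> A0 k_mean varpi :: real
    and u h :: "'s \<Rightarrow> real"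
  assumes "prob_space M"
    and "\<And>s. \<sigma> s > 0"
    and "\<And>s. distributed M lborel (\<epsilon> s) (\<lambda>t. ennreal (normal_density 0 (\<sigma> s) t))"
    and "prob_space.indep_vars M (\<lambda>_. borel) \<epsilon> UNIV"
    and "a > 0" "w0 > 0" "wl > 0" "Cn2 > 0"
    and "\<mu>x \<noteq> 0"
    and "\<mu>\<theta> = tracking_theta \<mu>x \<mu>y"
    and "\<mu>\<phi> = tracking_phi \<mu>x \<mu>y \<mu>z"
    and "w = beam_width w0 wl Cn2 (sqrt (\<mu>x\<^sup>2 + \<mu>y\<^sup>2 + \<mu>z\<^sup>2))"
    and "{l. eigenvalue (footprint_cov \<mu>x \<mu>\<theta> \<mu>\<phi> \<sigma>) l} = {l1, l2}"
    and "q = sqrt (min l1 l2 / max l1 l2)"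
    and "\<Omega> = l1 + l2"
    and "A0 = loss_A0 a w \<mu>\<theta> \<mu>\<phi>"
    and "k_mean = loss_k_mean a w \<mu>\<theta> \<mu>\<phi>"
    and "varpi = (1 + q\<^sup>2) * k_mean * w\<^sup>2 / (4 * q * \<Omega>)"
    and "u = (\<lambda>\<omega>. footprint_dist_first_order ((\<mu>x, \<mu>y, \<mu>z), (\<mu>\<theta>, \<mu>\<phi>)) (state_of (\<lambda>s. \<epsilon> s \<omega>)))"
    and "h = (\<lambda>\<omega>. geometric_loss A0 k_mean w (u \<omega>))"
  shows "distributed M lborel u (\<lambda>t. ennreal (hoyt_density q \<Omega> t))
       \<and> distributed M lborel h (\<lambda>x. ennreal (geometric_loss_density A0 q varpi x))"
proof -
  interpret prob_space M by fact
  let ?L = "lborel \<Otimes>\<^sub>M lborel :: (real \<times> real) measure"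
  note \<sigma> = assms(2) and normal = assms(3) and indep = indep_vars_distr_pair[OF assms(4)]
  have cos: "cos \<mu>\<theta> \<noteq> 0"
    using \<open>\<mu>x \<noteq> 0\<close> unfolding \<open>\<mu>\<theta> = _\<close> by (simp add: cos_tan_tracking_theta sum_power2_eq_zero_iff)
  have sin: "sin \<mu>\<phi> \<noteq> 0"
    using sin_cot_tracking_phi(1)[OF \<open>\<mu>x \<noteq> 0\<close>] unfolding \<open>\<mu>\<phi> = _\<close> by (simp add: less_imp_neq[symmetric])
  define c1 where "c1 = - tan \<mu>\<theta>"
  define c2 where "c2 = - (\<mu>x / (cos \<mu>\<theta>)\<^sup>2)"
  define c3 where "c3 = \<mu>x / ((sin \<mu>\<phi>)\<^sup>2 * cos \<mu>\<theta>)"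
  define c4 where "c4 = - (\<mu>x * cot \<mu>\<phi> * tan \<mu>\<theta> / cos \<mu>\<theta>)"
  define c5 where "c5 = - (cot \<mu>\<phi> / cos \<mu>\<theta>)"
  note c_defs = c1_def c2_def c3_def c4_def c5_def
  define s11 where "s11 = (\<sigma> Cy)\<^sup>2 + c1\<^sup>2 * (\<sigma> Cx)\<^sup>2 + c2\<^sup>2 * (\<sigma> Ctheta)\<^sup>2"
  define s12 where "s12 = c1 * c5 * (\<sigma> Cx)\<^sup>2 + c2 * c4 * (\<sigma> Ctheta)\<^sup>2"
  define s22 where "s22 = (\<sigma> Cz)\<^sup>2 + c3\<^sup>2 * (\<sigma> Cphi)\<^sup>2 + c4\<^sup>2 * (\<sigma> Ctheta)\<^sup>2 + c5\<^sup>2 * (\<sigma> Cx)\<^sup>2"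
  define X where "X \<omega> = \<epsilon> Cy \<omega> + c1 * \<epsilon> Cx \<omega> + c2 * \<epsilon> Ctheta \<omega>" for \<omega>
  define Y where "Y \<omega> = \<epsilon> Cz \<omega> + c5 * \<epsilon> Cx \<omega> + c4 * \<epsilon> Ctheta \<omega> + c3 * \<epsilon> Cphi \<omega>" for \<omega>

  have u: "u = (\<lambda>\<omega>. sqrt ((X \<omega>)\<^sup>2 + (Y \<omega>)\<^sup>2))"
    using cos sin footprint_tracking_eq_0[OF \<open>\<mu>x \<noteq> 0\<close>, of \<mu>y \<mu>z, folded \<open>\<mu>\<theta> = _\<close> \<open>\<mu>\<phi> = _\<close>]
    unfolding \<open>u = _\<close> footprint_dist_first_order_def state_of_def
    by (simp add: first_order_footprint_y first_order_footprint_z X_def Y_def c_defs algebra_simps)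

  let ?d = "\<lambda>s11 s22 s12. s11 * s22 - s12\<^sup>2 :: real"
  have sy: "0 < (\<sigma> Cy)\<^sup>2 + c1\<^sup>2 * (\<sigma> Cx)\<^sup>2 + c2\<^sup>2 * (\<sigma> Ctheta)\<^sup>2" "0 < (\<sigma> Cy)\<^sup>2 + c1\<^sup>2 * (\<sigma> Cx)\<^sup>2" "0 < (\<sigma> Cy)\<^sup>2"
    using \<sigma>[of Cy] by (simp_all add: add_pos_nonneg)
  have "0 < (\<sigma> Cy)\<^sup>2 * (\<sigma> Cz)\<^sup>2 - 0\<^sup>2"
    using \<sigma>[of Cy] \<sigma>[of Cz] by simp
  note d0 = this
  \<comment> \<open>Each determinant bound is the premise of the next update.
    \<open>simplified zero_le_power2, OF TrueI\<close> discharges the condition that the variance is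
    nonnegative.\<close>
  note d1 = binormal_det_update_pos[OF sy(3) d0, where a = c1 and b = c5 and t = "(\<sigma> Cx)\<^sup>2", simplified zero_le_power2, OF TrueI]
  note d2 = binormal_det_update_pos[OF sy(2) d1, where a = c2 and b = c4 and t = "(\<sigma> Ctheta)\<^sup>2", simplified zero_le_power2, OF TrueI]
  note d3 = binormal_det_update_pos[OF sy(1) d2, where a = 0 and b = c3 and t = "(\<sigma> Cphi)\<^sup>2", simplified zero_le_power2, OF TrueI]

  have "distributed M ?L (\<lambda>\<omega>. (\<epsilon> Cy \<omega>, \<epsilon> Cz \<omega>)) (\<lambda>z. ennreal (binormal_density ((\<sigma> Cy)\<^sup>2) 0 ((\<sigma> Cz)\<^sup>2) z))"
  proof -
    have "distributed M ?L (\<lambda>\<omega>. (\<epsilon> Cy \<omega>, \<epsilon> Cz \<omega>))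
        (\<lambda>(x, y). ennreal (normal_density 0 (\<sigma> Cy) x) * ennreal (normal_density 0 (\<sigma> Cz) y))"
      using indep[of Cz "{Cy}" "\<lambda>e. e Cy" lborel]
      by (intro distributed_joint_indep' sigma_finite_lborel normal) simp
    also have "(\<lambda>(x, y). ennreal (normal_density 0 (\<sigma> Cy) x) * ennreal (normal_density 0 (\<sigma> Cz) y)) =
        (\<lambda>z. ennreal (binormal_density ((\<sigma> Cy)\<^sup>2) 0 ((\<sigma> Cz)\<^sup>2) z))"
      using \<sigma> by (auto simp: fun_eq_iff binormal_density_uncorrelated ennreal_mult)
    finally show ?thesis .
  qed
  \<comment> \<open>The errors in x, \<theta> and \<phi> move the footprint along (c1, c5), (c2, c4)
    and (0, c3).\<close>
  from distributed_binormal_add_normal[OF this normal[of Cx], where a = c1 and b = c5]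
  have "distributed M ?L (\<lambda>\<omega>. (\<epsilon> Cy \<omega> + c1 * \<epsilon> Cx \<omega>, \<epsilon> Cz \<omega> + c5 * \<epsilon> Cx \<omega>))
      (\<lambda>z. ennreal (binormal_density ((\<sigma> Cy)\<^sup>2 + c1\<^sup>2 * (\<sigma> Cx)\<^sup>2) (0 + c1 * c5 * (\<sigma> Cx)\<^sup>2) ((\<sigma> Cz)\<^sup>2 + c5\<^sup>2 * (\<sigma> Cx)\<^sup>2) z))"
    using indep[of Cx "{Cy, Cz}" "\<lambda>e. (e Cy, e Cz)" ?L] sy d0 \<sigma> by simp
  from distributed_binormal_add_normal[OF this normal[of Ctheta], where a = c2 and b = c4]
  have "distributed M ?L
      (\<lambda>\<omega>. (\<epsilon> Cy \<omega> + c1 * \<epsilon> Cx \<omega> + c2 * \<epsilon> Ctheta \<omega>, \<epsilon> Cz \<omega> + c5 * \<epsilon> Cx \<omega> + c4 * \<epsilon> Ctheta \<omega>))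
      (\<lambda>z. ennreal (binormal_density ((\<sigma> Cy)\<^sup>2 + c1\<^sup>2 * (\<sigma> Cx)\<^sup>2 + c2\<^sup>2 * (\<sigma> Ctheta)\<^sup>2)
        (0 + c1 * c5 * (\<sigma> Cx)\<^sup>2 + c2 * c4 * (\<sigma> Ctheta)\<^sup>2)
        ((\<sigma> Cz)\<^sup>2 + c5\<^sup>2 * (\<sigma> Cx)\<^sup>2 + c4\<^sup>2 * (\<sigma> Ctheta)\<^sup>2) z))"
    using indep[of Ctheta "{Cy, Cz, Cx}" "\<lambda>e. (e Cy + c1 * e Cx, e Cz + c5 * e Cx)" ?L] sy d1 \<sigma> by simp
  \<comment> \<open>The polar angle affects only the z-coordinate of the footprint, whence the zero
    coefficient and the still unsimplified zero terms.\<close>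
  from distributed_binormal_add_normal[OF this normal[of Cphi], where a = 0 and b = c3]
  have "distributed M ?L (\<lambda>\<omega>. (X \<omega> + 0 * \<epsilon> Cphi \<omega>, Y \<omega>))
      (\<lambda>z. ennreal (binormal_density ((\<sigma> Cy)\<^sup>2 + c1\<^sup>2 * (\<sigma> Cx)\<^sup>2 + c2\<^sup>2 * (\<sigma> Ctheta)\<^sup>2 + 0\<^sup>2 * (\<sigma> Cphi)\<^sup>2)
        (0 + c1 * c5 * (\<sigma> Cx)\<^sup>2 + c2 * c4 * (\<sigma> Ctheta)\<^sup>2 + 0 * c3 * (\<sigma> Cphi)\<^sup>2)
        ((\<sigma> Cz)\<^sup>2 + c5\<^sup>2 * (\<sigma> Cx)\<^sup>2 + c4\<^sup>2 * (\<sigma> Ctheta)\<^sup>2 + c3\<^sup>2 * (\<sigma> Cphi)\<^sup>2) z))"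
    using indep[of Cphi "{Cy, Cz, Cx, Ctheta}"
        "\<lambda>e. (e Cy + c1 * e Cx + c2 * e Ctheta, e Cz + c5 * e Cx + c4 * e Ctheta)" ?L] sy d2 \<sigma>
    by (simp add: X_def Y_def)
  then have XY: "distributed M ?L (\<lambda>\<omega>. (X \<omega>, Y \<omega>)) (\<lambda>z. ennreal (binormal_density s11 s12 s22 z))"
    by (simp add: s11_def s12_def s22_def add_ac)

  have det_pos: "0 < s11 * s22 - s12\<^sup>2"
    using d3 by (simp add: s11_def s12_def s22_def add_ac)
  have s11_pos: "0 < s11" using sy by (simp add: s11_def)
  have s22_pos: "0 < s22" using \<sigma>[of Cz] by (simp add: s22_def add_pos_nonneg)
  have cov: "footprint_cov \<mu>x \<mu>\<theta> \<mu>\<phi> \<sigma> = mat_of_rows_list 2 [[s11, s12], [s12, s22]]"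
    by (simp only: footprint_cov_def Let_def s11_def s12_def s22_def c_defs)
  have "{l. l\<^sup>2 - (s11 + s22) * l + (s11 * s22 - s12\<^sup>2) = 0} = {l1, l2}"
    using assms(13) unfolding cov eigenvalue_mat2 by (simp add: power2_eq_square)
  note trace = quadratic_roots_vieta(1)[OF this] and det = quadratic_roots_vieta(2)[OF this]
  have l_pos: "0 < l1" "0 < l2"
  proof -
    have "0 < l1 * l2" "0 < l1 + l2" using det det_pos trace s11_pos s22_pos by auto
    then show "0 < l1" "0 < l2" by (auto simp: zero_less_mult_iff)
  qed
  have q_pos: "0 < q" and \<Omega>_pos: "0 < \<Omega>"
    using l_pos by (simp_all add: \<open>q = _\<close> \<open>\<Omega> = _\<close>)
  have "s11 * s22 - s12\<^sup>2 = (q * \<Omega> / (1 + q\<^sup>2))\<^sup>2"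
  proof -
    \<comment> \<open>With q^2 = m / n and 1 + q^2 = \<Omega> / n, the quotient q \<Omega> / (1 +
      q^2) is q n, whose square m n is the determinant whichever eigenvalue is larger.\<close>
    define m n where "m = min l1 l2" and "n = max l1 l2"
    have mn: "0 < m" "0 < n" "m + n = \<Omega>" "m * n = l1 * l2"
      using l_pos by (auto simp: m_def n_def \<open>\<Omega> = _\<close> min_def max_def)
    have q2: "q\<^sup>2 = m / n"
      using mn by (simp add: \<open>q = _\<close> m_def n_def)
    have "1 + q\<^sup>2 = \<Omega> / n"
      unfolding q2 mn(3)[symmetric] using mn by (simp add: field_simps)
    then have "(q * \<Omega> / (1 + q\<^sup>2))\<^sup>2 = q\<^sup>2 * n\<^sup>2"
      using \<Omega>_pos by (simp add: power_mult_distrib)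
    also have "\<dots> = m * n" unfolding q2 using mn by (simp add: power2_eq_square)
    finally show ?thesis using mn det by simp
  qed
  from distributed_hoyt[OF XY q_pos \<Omega>_pos _ this]
  have hoyt: "distributed M lborel u (\<lambda>t. ennreal (hoyt_density q \<Omega> t))"
    using trace unfolding u \<open>\<Omega> = _\<close> by simp
  have w: "0 < w" using beam_width_pos[OF \<open>0 < w0\<close>] by (simp add: \<open>w = _\<close>)
  have "distributed M lborel h (\<lambda>x. ennreal (geometric_loss_density A0 q varpi x))"
    unfolding \<open>h = _\<close>
    using loss_constants_pos[OF \<open>0 < a\<close> w cos sin]
    by (intro distributed_geometric_loss[OF \<open>prob_space M\<close> hoyt q_pos \<Omega>_pos _ _ w]) (simp_all add: assms(16,17,18))
  with hoyt show ?thesis by blast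
qed

end
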